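(* Assume that $\{f^n\}_{n\in\mathbb{N}}$, $\{g^n\}_{n\in\mathbb{N}}$ and $\{h^n\}_{n\in\mathbb{N}}$ are sequences converging weakly in $L^2(\mathbb{R}^2)$ to $f$, $g$ and $h$ respectively. Then the sequence $\{\mathcal{T}(f^n,g^n,h^n)\}_{n\in\mathbb{N}}$ converges weakly in $L^2(\mathbb{R}^2)$ to $\mathcal{T}(f,g,h)$.
   Context: For complex-valued functions on $\mathbb{R}^2$, $$\mathcal{T}(f,g,h)(\xi)=\int_{-1}^1\int_{\mathbb{R}^2}f(\xi+x)\,\overline{g(\xi+x+\lambda x^\perp)}\,h(\xi+\lambda x^\perp)\,dx\,d\lambda,$$ where $x^\perp$ is the rotation of $x\in\mathbb{R}^2$ by $+\pi/2$. This operator is bounded from $(L^2(\mathbb{R}^2))^3$ to $L^2(\mathbb{R}^2)$. *)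

theory Defs
  imports "HOL-Analysis.Analysis"
begin

definition perp :: "real^2 \<Rightarrow> real^2" where
  "perp x = vector [- (x $ 2), x $ 1]"

text \<open>
  Elements of \<open>L\<^sup>2(\<real>\<^sup>2)\<close> are represented by Lebesgue measurable functions.  None of the notions
  below depends on the representative chosen (the integrands of \<open>trilin_op\<close> change only on a
  null set for every \<open>l \<noteq> 0\<close>).
\<close>

definition L2 :: "(real^2 \<Rightarrow> complex) set" where
  "L2 = {f. f \<in> borel_measurable lebesgue \<and> integrable lebesgue (\<lambda>x. (norm (f x))\<^sup>2)}"

definition L2_inner :: "(real^2 \<Rightarrow> complex) \<Rightarrow> (real^2 \<Rightarrow> complex) \<Rightarrow> complex" where
  "L2_inner f g = (LINT x|lebesgue. f x * cnj (g x))"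

text \<open>
  Weak convergence in a Hilbert space, tested against the inner product with every element.
  Membership of the sequence and of the limit in \<open>L\<^sup>2\<close> is part of the notion.
\<close>

definition weakly_converges_L2 ::
  "(nat \<Rightarrow> real^2 \<Rightarrow> complex) \<Rightarrow> (real^2 \<Rightarrow> complex) \<Rightarrow> bool" where
  "weakly_converges_L2 u v \<longleftrightarrow>
     (\<forall>n. u n \<in> L2) \<and> v \<in> L2 \<and>
     (\<forall>k\<in>L2. (\<lambda>n. L2_inner (u n) k) \<longlonglongrightarrow> L2_inner v k)"

text \<open>
  For arguments in \<open>L\<^sup>2\<close> the integral converges absolutely for almost every \<open>\<xi>\<close>; at the remaining
  points the value is an artefact of the convention that a non-integrable function has integral 0.
\<close>

definition trilin_op ::
  "(real^2 \<Rightarrow> complex) \<Rightarrow> (real^2 \<Rightarrow> complex) \<Rightarrow> (real^2 \<Rightarrow> complex) \<Rightarrow> real^2 \<Rightarrow> complex" where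
  "trilin_op f g h \<xi> =
     (LINT l:{-1..1}|lebesgue. (LINT x|lebesgue.
        f (\<xi> + x) * cnj (g (\<xi> + x + l *\<^sub>R perp x)) * h (\<xi> + l *\<^sub>R perp x)))"

end

theory Submission
  imports Defs
begin

text \<open>
  The four points \<open>a = \<xi> + x\<close>, \<open>b = \<xi> + x + l x\<^sup>\<bottom>\<close>, \<open>c = \<xi> + l x\<^sup>\<bottom>\<close>, \<open>d = \<xi>\<close> are the corners of a
  rectangle with side ratio \<open>l\<close>, and pairing the operator with \<open>k \<in> L\<^sup>2\<close> integrates
  \<open>f(a) cnj(g(b)) h(c) cnj(k(d))\<close> over all rectangles with \<open>\<bar>l\<bar> \<le> 1\<close>.  For a fixed \<open>l\<close> this form is
  bounded but not weakly continuous; weak continuity is an effect of the average over \<open>l\<close>.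

  For fixed \<open>l\<close> the edge \<open>(b, c)\<close> is a measure-preserving choice of variables, and so is the edge
  \<open>(a, d)\<close>.  Hence the pairing equals the integral over \<open>(b, c)\<close> of \<open>cnj(g(b)) h(c) A\<^sub>f(b, c)\<close>, where
  \<open>A\<^sub>f(b, c)\<close> is the integral of \<open>f(a) cnj(k(d))\<close> over \<open>l\<close> (\<open>integral_borel_trilin_eq_rect_form\<close>,
  \<open>rect_form_eq_average\<close>).  The heart of the proof is that \<open>f \<mapsto> A\<^sub>f\<close> turns weak convergence to zero
  into convergence to zero in \<open>L\<^sup>2(\<real>\<^sup>4)\<close> (\<open>opp_edge_prod_average_tendsto_0\<close>).  Expanding the square,
  the squared norm of \<open>A\<^sub>f\<close> is the average over pairs \<open>(l, m)\<close> of the inner products of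
  \<open>f(a\<^sub>l) cnj(k(d\<^sub>l))\<close> and \<open>f(a\<^sub>m) cnj(k(d\<^sub>m))\<close>.  When \<open>l \<noteq> m\<close>, the points \<open>(a\<^sub>l, a\<^sub>m)\<close> can be used as variables
  with Jacobian \<open>(l - m)\<^sup>2\<close>, and likewise \<open>(d\<^sub>l, d\<^sub>m)\<close>.  So the inner product is a bilinear form in \<open>f\<close>
  and its conjugate with a kernel in \<open>L\<^sup>2(\<real>\<^sup>4)\<close>, and such Hilbert--Schmidt forms are weakly continuous
  (\<open>weakly_conv_kernel\<close>, \<open>opp_edge_prod_orthogonal\<close>).  All inner products are bounded uniformly in
  \<open>(l, m)\<close>, so dominated convergence applies although the norm of the kernel blows up on the diagonal.

  Consequently \<open>F n\<close> may be replaced by its limit \<open>f\<close>, uniformly over the bounded sequences \<open>G n\<close>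
  and \<open>H n\<close>; the form that remains has the fixed kernel \<open>A\<^sub>f\<close> and is again of Hilbert--Schmidt type.
  Boundedness of weakly convergent sequences is the uniform boundedness principle
  (\<open>weakly_conv_imp_bounded\<close>).  Finally, Lebesgue measurable functions are exchanged for Borel
  representatives, to which Fubini's theorem on product measures applies
  (\<open>trilin_op_eq_borel_trilin\<close>).
\<close>

section \<open>Square-integrable functions and their bilinear pairing\<close>

definition sq_integrable :: "'a measure \<Rightarrow> ('a \<Rightarrow> complex) \<Rightarrow> bool" where
  "sq_integrable M f \<longleftrightarrow> f \<in> borel_measurable M \<and> integrable M (\<lambda>x. (cmod (f x))\<^sup>2)"

definition l2norm :: "'a measure \<Rightarrow> ('a \<Rightarrow> complex) \<Rightarrow> real" where
  "l2norm M f = sqrt (LINT x|M. (cmod (f x))\<^sup>2)"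

lemma sq_integrable_integrable: "sq_integrable M f \<Longrightarrow> integrable M (\<lambda>x. (cmod (f x))\<^sup>2)"
  by (simp add: sq_integrable_def)

lemma l2norm_nonneg [simp]: "0 \<le> l2norm M f"
  by (simp add: l2norm_def)

lemma l2norm_power2: "(l2norm M f)\<^sup>2 = (LINT x|M. (cmod (f x))\<^sup>2)"
  by (simp add: l2norm_def)

lemma sq_integrable_iff_nn_integral:
  assumes [measurable]: "f \<in> borel_measurable M"
  shows "sq_integrable M f \<longleftrightarrow> (\<integral>\<^sup>+x. ennreal ((cmod (f x))\<^sup>2) \<partial>M) < \<infinity>"
  by (simp add: sq_integrable_def integrable_iff_bounded)

lemma nn_integral_eq_l2norm:
  assumes "sq_integrable M f"
  shows "(\<integral>\<^sup>+x. ennreal ((cmod (f x))\<^sup>2) \<partial>M) = ennreal ((l2norm M f)\<^sup>2)"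
  using nn_integral_eq_integral[OF sq_integrable_integrable[OF assms]]
  by (simp add: l2norm_power2)

lemma sq_integrable_nn_le:
  assumes "f \<in> borel_measurable M" "(\<integral>\<^sup>+x. ennreal ((cmod (f x))\<^sup>2) \<partial>M) \<le> ennreal c" "0 \<le> c"
  shows "sq_integrable M f" "(l2norm M f)\<^sup>2 \<le> c"
proof -
  show *: "sq_integrable M f"
    using assms(2) by (simp add: sq_integrable_iff_nn_integral[OF assms(1)] le_less_trans)
  show "(l2norm M f)\<^sup>2 \<le> c"
    using assms(2,3) by (simp add: nn_integral_eq_l2norm[OF *])
qed

lemma borel_measurable_cnj [measurable]: "cnj \<in> borel_measurable borel"
  by (intro borel_measurable_continuous_onI continuous_intros)

lemma sq_integrable_cnj:
  assumes "sq_integrable M f" shows "sq_integrable M (\<lambda>x. cnj (f x))"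
  using assms measurable_compose[OF _ borel_measurable_cnj] by (auto simp: sq_integrable_def)

lemma l2norm_cnj [simp]: "l2norm M (\<lambda>x. cnj (f x)) = l2norm M f"
  by (simp add: l2norm_def)

lemma sq_integrable_cmult:
  assumes "sq_integrable M f" shows "sq_integrable M (\<lambda>x. c * f x)"
  using assms by (auto simp: sq_integrable_def norm_mult power_mult_distrib)

lemma l2norm_cmult: "l2norm M (\<lambda>x. c * f x) = cmod c * l2norm M f"
  by (simp add: l2norm_def norm_mult power_mult_distrib real_sqrt_mult)

lemma cmod_add_power2_le: "(cmod (a + b))\<^sup>2 \<le> 2 * (cmod a)\<^sup>2 + 2 * (cmod b)\<^sup>2"
proof -
  have "(cmod (a + b))\<^sup>2 \<le> (cmod a + cmod b)\<^sup>2"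
    by (intro power_mono norm_triangle_ineq) auto
  also have "\<dots> \<le> 2 * (cmod a)\<^sup>2 + 2 * (cmod b)\<^sup>2"
    using sum_squares_bound[of "cmod a" "cmod b"] by (simp add: power2_sum)
  finally show ?thesis .
qed

lemma sq_integrable_add:
  assumes "sq_integrable M f" "sq_integrable M g"
  shows "sq_integrable M (\<lambda>x. f x + g x)"
  unfolding sq_integrable_def
proof
  show "(\<lambda>x. f x + g x) \<in> borel_measurable M"
    using assms by (auto simp: sq_integrable_def)
  show "integrable M (\<lambda>x. (cmod (f x + g x))\<^sup>2)"
  proof (rule Bochner_Integration.integrable_bound)
    show "integrable M (\<lambda>x. 2 * (cmod (f x))\<^sup>2 + 2 * (cmod (g x))\<^sup>2)"
      using assms by (simp add: sq_integrable_def)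
    show "(\<lambda>x. (cmod (f x + g x))\<^sup>2) \<in> borel_measurable M"
      using assms by (auto simp: sq_integrable_def)
    have "norm ((cmod (f x + g x))\<^sup>2) \<le> norm (2 * (cmod (f x))\<^sup>2 + 2 * (cmod (g x))\<^sup>2)" for x
      using cmod_add_power2_le[of "f x" "g x"] by simp
    then show "AE x in M. norm ((cmod (f x + g x))\<^sup>2) \<le> norm (2 * (cmod (f x))\<^sup>2 + 2 * (cmod (g x))\<^sup>2)"
      by simp
  qed
qed

lemma sq_integrable_diff:
  assumes "sq_integrable M f" "sq_integrable M g"
  shows "sq_integrable M (\<lambda>x. f x - g x)"
  using sq_integrable_add[OF assms(1) sq_integrable_cmult[OF assms(2), of "-1"]] by simp

lemma integrable_mult_sq_integrable:
  assumes "sq_integrable M f" "sq_integrable M g"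
  shows "integrable M (\<lambda>x. f x * g x)"
proof (rule Bochner_Integration.integrable_bound)
  show "integrable M (\<lambda>x. (cmod (f x))\<^sup>2 + (cmod (g x))\<^sup>2)"
    using assms by (auto simp: sq_integrable_def)
  show "(\<lambda>x. f x * g x) \<in> borel_measurable M"
    using assms by (auto simp: sq_integrable_def)
  have "cmod a * cmod b \<le> (cmod a)\<^sup>2 + (cmod b)\<^sup>2" for a b
    using sum_squares_bound[of "cmod a" "cmod b"] mult_nonneg_nonneg[OF norm_ge_zero[of a] norm_ge_zero[of b]]
    by linarith
  then have "norm (f x * g x) \<le> norm ((cmod (f x))\<^sup>2 + (cmod (g x))\<^sup>2)" for x
    by (simp add: norm_mult)
  then show "AE x in M. norm (f x * g x) \<le> norm ((cmod (f x))\<^sup>2 + (cmod (g x))\<^sup>2)"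
    by (intro AE_I2)
qed

lemma Cauchy_Schwarz_norm:
  assumes "sq_integrable M f" "sq_integrable M g"
  shows "(LINT x|M. cmod (f x * g x)) \<le> l2norm M f * l2norm M g"
proof -
  have [measurable]: "f \<in> borel_measurable M" "g \<in> borel_measurable M"
    using assms by (auto simp: sq_integrable_def)
  let ?I = "LINT x|M. cmod (f x * g x)"
  have "ennreal (?I\<^sup>2) = (\<integral>\<^sup>+x. ennreal (cmod (f x)) * ennreal (cmod (g x)) \<partial>M)\<^sup>2"
    using nn_integral_eq_integral[OF integrable_norm[OF integrable_mult_sq_integrable[OF assms]]]
    by (simp add: norm_mult ennreal_mult' ennreal_power)
  also have "\<dots> \<le> (\<integral>\<^sup>+x. (ennreal (cmod (f x)))\<^sup>2 \<partial>M) * (\<integral>\<^sup>+x. (ennreal (cmod (g x)))\<^sup>2 \<partial>M)"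
    by (rule Cauchy_Schwarz_nn_integral) auto
  also have "\<dots> = ennreal ((l2norm M f * l2norm M g)\<^sup>2)"
    using assms by (simp add: ennreal_power nn_integral_eq_l2norm ennreal_mult power_mult_distrib)
  finally have "?I\<^sup>2 \<le> (l2norm M f * l2norm M g)\<^sup>2"
    by simp
  then show ?thesis
    by (rule power2_le_imp_le) simp
qed

lemma Cauchy_Schwarz_integral:
  assumes "sq_integrable M f" "sq_integrable M g"
  shows "cmod (LINT x|M. f x * g x) \<le> l2norm M f * l2norm M g"
  by (rule order_trans[OF integral_norm_bound Cauchy_Schwarz_norm[OF assms]])

section \<open>Weak convergence and uniform boundedness\<close>

text \<open>
  Test functions are paired bilinearly, without a conjugate, so that products of several functions
  can be rearranged freely; since they range over a set closed under conjugation, this is the usual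
  notion of weak convergence.
\<close>

definition weakly_conv :: "'a measure \<Rightarrow> (nat \<Rightarrow> 'a \<Rightarrow> complex) \<Rightarrow> ('a \<Rightarrow> complex) \<Rightarrow> bool" where
  "weakly_conv M u v \<longleftrightarrow> (\<forall>n. sq_integrable M (u n)) \<and> sq_integrable M v \<and>
     (\<forall>k. sq_integrable M k \<longrightarrow> (\<lambda>n. LINT x|M. u n x * k x) \<longlonglongrightarrow> (LINT x|M. v x * k x))"

lemma weakly_conv_cnj:
  assumes "weakly_conv M u v"
  shows "weakly_conv M (\<lambda>n x. cnj (u n x)) (\<lambda>x. cnj (v x))"
  unfolding weakly_conv_def
proof (intro conjI allI impI)
  fix k assume "sq_integrable M k"
  then have "(\<lambda>n. LINT x|M. u n x * cnj (k x)) \<longlonglongrightarrow> (LINT x|M. v x * cnj (k x))"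
    using assms sq_integrable_cnj by (auto simp: weakly_conv_def)
  then have "(\<lambda>n. cnj (LINT x|M. u n x * cnj (k x))) \<longlonglongrightarrow> cnj (LINT x|M. v x * cnj (k x))"
    by (rule tendsto_cnj)
  then show "(\<lambda>n. LINT x|M. cnj (u n x) * k x) \<longlonglongrightarrow> (LINT x|M. cnj (v x) * k x)"
    by (simp del: Bochner_Integration.integral_cnj add: Bochner_Integration.integral_cnj[symmetric])
qed (use assms sq_integrable_cnj in \<open>auto simp: weakly_conv_def\<close>)

lemma weakly_conv_diff:
  assumes "weakly_conv M u v"
  shows "weakly_conv M (\<lambda>n x. u n x - v x) (\<lambda>x. 0)"
  unfolding weakly_conv_def
proof (intro conjI allI impI)
  fix k assume k: "sq_integrable M k"
  have u: "sq_integrable M (u n)" and v: "sq_integrable M v" for n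
    using assms by (auto simp: weakly_conv_def)
  have "(\<lambda>n. (LINT x|M. u n x * k x) - (LINT x|M. v x * k x)) \<longlonglongrightarrow> 0"
    using assms k by (auto simp: weakly_conv_def LIM_zero_iff)
  then show "(\<lambda>n. LINT x|M. (u n x - v x) * k x) \<longlonglongrightarrow> (LINT x|M. 0 * k x)"
    using integrable_mult_sq_integrable[OF u k] integrable_mult_sq_integrable[OF v k]
    by (simp add: left_diff_distrib)
qed (use assms sq_integrable_diff in \<open>auto simp: weakly_conv_def sq_integrable_def\<close>)

text \<open>
  The uniform boundedness principle, by Sokal's gliding hump.  If the norms were unbounded, pick
  terms with norm at least \<open>4 ^ j\<close> and add up vectors of norm \<open>3 ^ - (j + 1)\<close> in their (conjugate)
  directions; a suitable choice of signs makes the pairing with the \<open>j\<close>-th partial sum at least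
  \<open>3 ^ - (j + 1) * 4 ^ j\<close>, and all later summands together can destroy only half of it.
\<close>

lemma weakly_conv_imp_bounded:
  assumes weak: "weakly_conv M u v"
  obtains C where "\<And>n. l2norm M (u n) \<le> C" "0 \<le> C"
proof (rule ccontr)
  assume "\<not> thesis"
  then have unb: "\<exists>n. l2norm M (u n) > C" for C
    using that by (metis max.cobounded2 max.coboundedI1 not_le_imp_less)
  have u: "sq_integrable M (u n)" for n
    using weak by (auto simp: weakly_conv_def)
  obtain m where m: "\<And>j::nat. l2norm M (u (m j)) > 4 ^ j"
    using choice[of "\<lambda>j n. l2norm M (u n) > 4 ^ j"] unb by blast
  define U where "U j = u (m j)" for j
  define e where "e j x = cnj (U j x) / complex_of_real (l2norm M (U j))" for j x
  have U: "sq_integrable M (U j)" for j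
    by (simp add: U_def u)
  have Upos: "l2norm M (U j) > 0" for j
    using m[of j] by (simp add: U_def) (meson less_trans zero_less_numeral zero_less_power)
  have e: "sq_integrable M (e j)" for j
    using sq_integrable_cmult[OF sq_integrable_cnj[OF U], of "1 / complex_of_real (l2norm M (U j))" j]
    by (simp add: e_def[abs_def])
  have e_norm: "l2norm M (e j) = 1" for j
    using l2norm_cmult[of M "1 / complex_of_real (l2norm M (U j))" "\<lambda>x. cnj (U j x)"] Upos[of j]
    by (simp add: e_def[abs_def] norm_divide)
  have Ue: "(LINT x|M. U j x * e j x) = complex_of_real (l2norm M (U j))" for j
  proof -
    have "(LINT x|M. U j x * e j x)
        = (LINT x|M. complex_of_real ((cmod (U j x))\<^sup>2) / complex_of_real (l2norm M (U j)))"
      by (simp add: e_def complex_norm_square del: of_real_power)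
    also have "\<dots> = complex_of_real ((l2norm M (U j))\<^sup>2) / complex_of_real (l2norm M (U j))"
      by (simp add: l2norm_power2 del: of_real_power)
    finally show ?thesis
      using Upos[of j] by (simp add: power2_eq_square)
  qed
  define r :: "nat \<Rightarrow> real" where "r j = (1/3) ^ Suc j" for j
  have r_pos: "r j > 0" for j by (simp add: r_def)
  \<comment> \<open>The partial sums: one of the two signs is good because \<open>b\<close> is half of the difference of
    \<open>a + b\<close> and \<open>a - b\<close>, so the larger of the two has at least its modulus.\<close>
  have "\<exists>X. X 0 = (\<lambda>x. 0) \<and> (\<forall>j. sq_integrable M (X j) \<and>
      (\<exists>\<sigma>. \<bar>\<sigma>\<bar> = 1 \<and> X (Suc j) = (\<lambda>x. X j x + complex_of_real (\<sigma> * r j) * e j x)) \<and>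
      cmod (LINT x|M. U j x * X (Suc j) x) \<ge> r j * l2norm M (U j))"
  proof -
    let ?Q = "\<lambda>j Y Z. (\<exists>\<sigma>. \<bar>\<sigma>\<bar> = 1 \<and> Z = (\<lambda>x. Y x + complex_of_real (\<sigma> * r j) * e j x)) \<and>
      cmod (LINT x|M. U j x * Z x) \<ge> r j * l2norm M (U j)"
    have step: "\<exists>Z. sq_integrable M Z \<and> ?Q j Y Z" if Y: "sq_integrable M Y" for j Y
    proof -
      let ?Z = "\<lambda>\<sigma> x. Y x + complex_of_real (\<sigma> * r j) * e j x"
      let ?a = "LINT x|M. U j x * Y x"
      let ?b = "complex_of_real (r j * l2norm M (U j))"
      have int: "(LINT x|M. U j x * ?Z \<sigma> x) = ?a + complex_of_real \<sigma> * ?b" for \<sigma>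
      proof -
        have "(LINT x|M. U j x * ?Z \<sigma> x)
            = (LINT x|M. U j x * Y x + complex_of_real (\<sigma> * r j) * (U j x * e j x))"
          by (simp add: algebra_simps)
        also have "\<dots> = ?a + complex_of_real (\<sigma> * r j) * (LINT x|M. U j x * e j x)"
          by (subst Bochner_Integration.integral_add)
             (auto intro!: integrable_mult_sq_integrable integrable_mult_right U Y e)
        finally show ?thesis by (simp add: Ue)
      qed
      have "cmod ?b \<le> max (cmod (?a + ?b)) (cmod (?a - ?b))"
        using norm_triangle_ineq4[of "?a + ?b" "?a - ?b"] by (simp add: norm_mult max_def)
      then have "\<exists>\<sigma>::real. \<bar>\<sigma>\<bar> = 1 \<and> cmod ?b \<le> cmod (?a + complex_of_real \<sigma> * ?b)"
        by (cases "cmod ?b \<le> cmod (?a + ?b)") (auto intro: exI[of _ 1] exI[of _ "-1"])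
      then obtain \<sigma> :: real where \<sigma>: "\<bar>\<sigma>\<bar> = 1" "cmod ?b \<le> cmod (?a + complex_of_real \<sigma> * ?b)"
        by blast
      have "sq_integrable M (?Z \<sigma>)"
        by (intro sq_integrable_add sq_integrable_cmult Y e)
      moreover have "?Q j Y (?Z \<sigma>)"
        using \<sigma> r_pos[of j] int[of \<sigma>] by (auto simp: norm_mult)
      ultimately show ?thesis by blast
    qed
    have "\<exists>X. \<forall>j. (sq_integrable M (X j) \<and> (j = 0 \<longrightarrow> X j = (\<lambda>x. 0))) \<and> ?Q j (X j) (X (Suc j))"
      by (rule dependent_nat_choice) (use step in \<open>auto simp: sq_integrable_def\<close>)
    then obtain X where "\<And>j. sq_integrable M (X j) \<and> (j = 0 \<longrightarrow> X j = (\<lambda>x. 0))"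
      and "\<And>j. ?Q j (X j) (X (Suc j))"
      by blast
    then show ?thesis
      by (intro exI[of _ X]) blast
  qed
  then obtain X where X0: "X 0 = (\<lambda>x. 0)" and X: "\<And>j. sq_integrable M (X j)"
    and ex: "\<And>j. \<exists>\<sigma>. \<bar>\<sigma>\<bar> = 1 \<and> X (Suc j) = (\<lambda>x. X j x + complex_of_real (\<sigma> * r j) * e j x)"
    and XU: "\<And>j. cmod (LINT x|M. U j x * X (Suc j) x) \<ge> r j * l2norm M (U j)"
    by blast
  obtain \<sigma> :: "nat \<Rightarrow> real" where \<sigma>: "\<And>j. \<bar>\<sigma> j\<bar> = 1"
    and XSuc: "\<And>j. X (Suc j) = (\<lambda>x. X j x + complex_of_real (\<sigma> j * r j) * e j x)"
    using ex by metis
  define w where "w j x = complex_of_real (\<sigma> j * r j) * e j x" for j x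
  have w: "sq_integrable M (w j)" for j
    unfolding w_def by (intro sq_integrable_cmult e)
  have w_norm: "l2norm M (w j) = r j" for j
    using \<sigma>[of j] r_pos[of j] unfolding w_def[abs_def] l2norm_cmult
    by (simp add: e_norm norm_mult)
  have w_cmod: "cmod (w j x) = r j * cmod (e j x)" for j x
    using \<sigma>[of j] r_pos[of j] by (simp add: w_def norm_mult)
  have X_sum: "X j x = (\<Sum>i<j. w i x)" for j x
    by (induction j) (auto simp: X0 XSuc w_def)
  have r_sums: "(\<lambda>i. r (i + j)) sums (r j * (3/2))" for j
    using sums_mult[OF geometric_sums[of "1/3::real"], of "(1/3) ^ Suc j"]
    by (simp add: r_def power_add mult_ac)
  have r_summable: "summable r" and r_suminf: "suminf r = 1/2"
  proof -
    have "r 0 * (3/2) = 1/2" by (simp add: r_def)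
    then have "r sums (1/2)" using r_sums[of 0] by (simp add: r_def[of 0])
    then show "summable r" "suminf r = 1/2" by (auto simp: sums_iff)
  qed

  define S where "S x = (\<Sum>i. r i * (cmod (e i x))\<^sup>2)" for x
  have e_int: "integrable M (\<lambda>x. (cmod (e i x))\<^sup>2)" "(LINT x|M. (cmod (e i x))\<^sup>2) = 1" for i
    using e[of i] e_norm[of i] l2norm_power2[of M "e i"] by (auto simp: sq_integrable_def)
  have nn_fin: "(\<integral>\<^sup>+x. (\<Sum>i. ennreal (r i * (cmod (e i x))\<^sup>2)) \<partial>M) = ennreal (1/2)"
  proof -
    have [measurable]: "e i \<in> borel_measurable M" for i
      using e by (simp add: sq_integrable_def)
    have "(\<integral>\<^sup>+x. (\<Sum>i. ennreal (r i * (cmod (e i x))\<^sup>2)) \<partial>M)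
        = (\<Sum>i. \<integral>\<^sup>+x. ennreal (r i * (cmod (e i x))\<^sup>2) \<partial>M)"
      by (rule nn_integral_suminf) auto
    also have "\<dots> = (\<Sum>i. ennreal (r i))"
      using e_int r_pos by (subst nn_integral_eq_integral) (auto intro!: AE_I2 simp: less_imp_le)
    also have "\<dots> = ennreal (suminf r)"
      using r_pos r_summable by (intro suminf_ennreal2) (auto simp: less_imp_le)
    also have "\<dots> = ennreal (1/2)"
      by (simp only: r_suminf)
    finally show ?thesis .
  qed
  have AE_S: "AE x in M. summable (\<lambda>i. r i * (cmod (e i x))\<^sup>2)"
  proof -
    have [measurable]: "e i \<in> borel_measurable M" for i
      using e by (simp add: sq_integrable_def)
    have "AE x in M. (\<Sum>i. ennreal (r i * (cmod (e i x))\<^sup>2)) \<noteq> \<infinity>"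
      using nn_fin by (intro nn_integral_PInf_AE) auto
    then show ?thesis
      by eventually_elim
         (use r_pos in \<open>auto intro!: summable_suminf_not_top simp: less_imp_le\<close>)
  qed
  have S_int: "integrable M S"
    unfolding S_def
  proof (rule integrable_suminf)
    show "AE x in M. summable (\<lambda>i. norm (r i * (cmod (e i x))\<^sup>2))"
      using AE_S r_pos by (simp add: abs_mult less_imp_le)
    show "summable (\<lambda>i. LINT x|M. norm (r i * (cmod (e i x))\<^sup>2))"
      using e_int r_pos r_summable by (simp add: abs_mult less_imp_le)
  qed (use e_int in simp)
  \<comment> \<open>Weighting the squares with the same geometric weights gives both almost everywhere convergence
    and, by the Cauchy--Schwarz inequality for partial sums, the majorant \<open>S\<close> of \<open>\<bar>k\<bar>\<^sup>2\<close>.\<close>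
  have AE_w: "AE x in M. summable (\<lambda>i. cmod (w i x))"
    using AE_S
  proof eventually_elim
    case (elim x)
    have "cmod (w i x) \<le> r i + r i * (cmod (e i x))\<^sup>2" for i
    proof -
      have "cmod (e i x) \<le> 1 + (cmod (e i x))\<^sup>2"
        using sum_squares_bound[of 1 "cmod (e i x)", unfolded power_one] norm_ge_zero[of "e i x"]
        by linarith
      then show ?thesis
        using mult_left_mono[of "cmod (e i x)" "1 + (cmod (e i x))\<^sup>2" "r i"] r_pos[of i]
        by (simp add: w_cmod distrib_left)
    qed
    then show ?case
      by (intro summable_comparison_test'[OF summable_add[OF r_summable elim], of 0]) auto
  qed
  define k where "k x = (\<Sum>i. w i x)" for x
  have k_meas: "k \<in> borel_measurable M"
    unfolding k_def using w by (intro borel_measurable_suminf) (auto simp: sq_integrable_def)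
  have k_le: "AE x in M. (cmod (k x))\<^sup>2 \<le> S x"
    using AE_S AE_w
  proof eventually_elim
    case (elim x)
    have part: "(cmod (\<Sum>i<n. w i x))\<^sup>2 \<le> S x" for n
    proof -
      have "(cmod (\<Sum>i<n. w i x))\<^sup>2 \<le> (\<Sum>i<n. r i * cmod (e i x))\<^sup>2"
        using norm_sum[of "\<lambda>i. w i x" "{..<n}"] by (intro power_mono) (auto simp: w_cmod)
      also have "\<dots> = (\<Sum>i<n. sqrt (r i) * (sqrt (r i) * cmod (e i x)))\<^sup>2"
        using r_pos by (simp add: less_imp_le flip: mult.assoc)
      also have "\<dots> \<le> (\<Sum>i<n. (sqrt (r i))\<^sup>2) * (\<Sum>i<n. (sqrt (r i) * cmod (e i x))\<^sup>2)"
        by (rule Cauchy_Schwarz_ineq_sum)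
      also have "\<dots> = (\<Sum>i<n. r i) * (\<Sum>i<n. r i * (cmod (e i x))\<^sup>2)"
        using r_pos by (simp add: power_mult_distrib less_imp_le)
      also have "\<dots> \<le> 1 * S x"
      proof (intro mult_mono)
        show "(\<Sum>i<n. r i) \<le> 1"
          using sum_le_suminf[OF r_summable, of "{..<n}"] r_pos r_suminf by (simp add: less_imp_le)
        show "(\<Sum>i<n. r i * (cmod (e i x))\<^sup>2) \<le> S x"
          unfolding S_def using r_pos by (intro sum_le_suminf elim(1)) (auto simp: less_imp_le)
      qed (use r_pos in \<open>auto intro!: sum_nonneg simp: less_imp_le\<close>)
      finally show ?thesis by simp
    qed
    have "(\<lambda>n. (cmod (\<Sum>i<n. w i x))\<^sup>2) \<longlonglongrightarrow> (cmod (k x))\<^sup>2"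
      unfolding k_def using summable_LIMSEQ[OF summable_norm_cancel[OF elim(2)]]
      by (intro tendsto_intros)
    then show ?case
      using part by (intro LIMSEQ_le_const2) auto
  qed
  have k: "sq_integrable M k"
    unfolding sq_integrable_def
  proof
    show "integrable M (\<lambda>x. (cmod (k x))\<^sup>2)"
      by (rule Bochner_Integration.integrable_bound[OF S_int])
         (use k_meas k_le in \<open>auto intro: order_trans\<close>)
  qed (rule k_meas)

  have pair_sums: "(\<lambda>i. LINT x|M. U j x * w i x) sums (LINT x|M. U j x * k x)" for j
  proof -
    have bd: "(LINT x|M. cmod (U j x * w i x)) \<le> l2norm M (U j) * r i" for i
      using Cauchy_Schwarz_norm[OF U w, of j i] by (simp add: w_norm)
    have "(\<lambda>i. LINT x|M. U j x * w i x) sums (LINT x|M. (\<Sum>i. U j x * w i x))"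
    proof (rule sums_integral)
      show "integrable M (\<lambda>x. U j x * w i x)" for i
        by (intro integrable_mult_sq_integrable U w)
      show "AE x in M. summable (\<lambda>i. cmod (U j x * w i x))"
        using AE_w by eventually_elim (auto simp: norm_mult intro: summable_mult)
      show "summable (\<lambda>i. LINT x|M. cmod (U j x * w i x))"
        by (rule summable_comparison_test'[OF summable_mult[OF r_summable], of 0])
           (use bd in auto)
    qed
    also have "(LINT x|M. (\<Sum>i. U j x * w i x)) = (LINT x|M. U j x * k x)"
    proof (rule integral_cong_AE)
      show "AE x in M. (\<Sum>i. U j x * w i x) = U j x * k x"
        using AE_w by eventually_elim (simp add: k_def suminf_mult summable_norm_cancel)
      show "(\<lambda>x. \<Sum>i. U j x * w i x) \<in> borel_measurable M"
        by (intro borel_measurable_suminf borel_measurable_integrable integrable_mult_sq_integrable U w)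
      show "(\<lambda>x. U j x * k x) \<in> borel_measurable M"
        by (intro borel_measurable_integrable integrable_mult_sq_integrable U k)
    qed
    finally show ?thesis .
  qed
  have lower: "cmod (LINT x|M. U j x * k x) \<ge> r j * l2norm M (U j) / 2" for j
  proof -
    let ?p = "\<lambda>i. LINT x|M. U j x * w i x"
    have p_le: "cmod (?p i) \<le> l2norm M (U j) * r i" for i
      using Cauchy_Schwarz_integral[OF U w, of j i] by (simp add: w_norm)
    have "(\<lambda>i. ?p (i + Suc j)) sums ((LINT x|M. U j x * k x) - (\<Sum>i<Suc j. ?p i))"
      using pair_sums by (rule sums_split_initial_segment)
    moreover have "(\<Sum>i<Suc j. ?p i) = (LINT x|M. U j x * X (Suc j) x)"
      unfolding X_sum sum_distrib_left
      by (subst Bochner_Integration.integral_sum)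
         (auto intro!: integrable_mult_sq_integrable U w)
    ultimately have tail: "(\<lambda>i. ?p (i + Suc j)) sums
        ((LINT x|M. U j x * k x) - (LINT x|M. U j x * X (Suc j) x))" by simp
    have rs: "(\<lambda>i. l2norm M (U j) * r (i + Suc j)) sums (l2norm M (U j) * (r j / 2))"
      using sums_mult[OF r_sums[of "Suc j"], of "l2norm M (U j)"] by (simp add: r_def)
    have "cmod ((LINT x|M. U j x * k x) - (LINT x|M. U j x * X (Suc j) x))
        \<le> l2norm M (U j) * (r j / 2)"
      using norm_suminf_le[of "\<lambda>i. ?p (i + Suc j)", OF _ sums_summable[OF rs]] p_le
            sums_unique[OF tail] sums_unique[OF rs] by simp
    then show ?thesis
      using XU[of j] norm_triangle_ineq2[of "LINT x|M. U j x * X (Suc j) x" "LINT x|M. U j x * k x"]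
      by (simp add: norm_minus_commute mult.commute)
  qed
  have "(\<lambda>n. LINT x|M. u n x * k x) \<longlonglongrightarrow> (LINT x|M. v x * k x)"
    using weak k by (auto simp: weakly_conv_def)
  then have "Bseq (\<lambda>n. LINT x|M. u n x * k x)"
    by (rule convergent_imp_Bseq[OF convergentI])
  then obtain B where B: "\<And>n. cmod (LINT x|M. u n x * k x) \<le> B"
    by (auto simp: Bseq_def)
  have "(4/3) ^ j \<le> 6 * B" for j :: nat
  proof -
    have "r j * 4 ^ j \<le> r j * l2norm M (U j)"
      using m[of j] r_pos[of j] by (simp add: U_def)
    also have "\<dots> \<le> 2 * B"
      using lower[of j] B[of "m j"] by (simp add: U_def)
    finally show ?thesis
      by (simp add: r_def power_divide field_simps)
  qed
  moreover obtain j :: nat where "6 * B < (4/3) ^ j"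
    using real_arch_pow[of "4/3" "6 * B"] by auto
  ultimately show False
    by (meson not_le)
qed

section \<open>Square-integrable kernels\<close>

lemma sq_integrable_tensor:
  assumes "sigma_finite_measure N" and f: "sq_integrable M f" and g: "sq_integrable N g"
  shows "sq_integrable (M \<Otimes>\<^sub>M N) (\<lambda>p. f (fst p) * g (snd p))"
    and "l2norm (M \<Otimes>\<^sub>M N) (\<lambda>p. f (fst p) * g (snd p)) \<le> l2norm M f * l2norm N g"
proof -
  interpret N: sigma_finite_measure N by fact
  have [measurable]: "f \<in> borel_measurable M" "g \<in> borel_measurable N"
    using f g by (auto simp: sq_integrable_def)
  have "(\<integral>\<^sup>+p. ennreal ((cmod (f (fst p) * g (snd p)))\<^sup>2) \<partial>(M \<Otimes>\<^sub>M N))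
      = (\<integral>\<^sup>+x. \<integral>\<^sup>+y. ennreal ((cmod (f x))\<^sup>2) * ennreal ((cmod (g y))\<^sup>2) \<partial>N \<partial>M)"
    by (subst N.nn_integral_fst[symmetric])
       (auto simp: norm_mult power_mult_distrib ennreal_mult)
  also have "\<dots> = ennreal ((l2norm M f * l2norm N g)\<^sup>2)"
    using f g
    by (simp add: nn_integral_cmult nn_integral_multc nn_integral_eq_l2norm
        ennreal_mult power_mult_distrib)
  finally have "(\<integral>\<^sup>+p. ennreal ((cmod (f (fst p) * g (snd p)))\<^sup>2) \<partial>(M \<Otimes>\<^sub>M N))
      \<le> ennreal ((l2norm M f * l2norm N g)\<^sup>2)" by simp
  note * = sq_integrable_nn_le[OF _ this]
  show "sq_integrable (M \<Otimes>\<^sub>M N) (\<lambda>p. f (fst p) * g (snd p))"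
    by (rule *(1)) auto
  show "l2norm (M \<Otimes>\<^sub>M N) (\<lambda>p. f (fst p) * g (snd p)) \<le> l2norm M f * l2norm N g"
    by (rule power2_le_imp_le, rule *(2)) auto
qed

lemma sq_integrable_kernel_slice:
  assumes "sigma_finite_measure M" "sigma_finite_measure N"
    and K: "sq_integrable (M \<Otimes>\<^sub>M N) K"
  shows "AE y in N. sq_integrable M (\<lambda>x. K (x, y))"
    and "integrable N (\<lambda>y. (l2norm M (\<lambda>x. K (x, y)))\<^sup>2)"
proof -
  interpret pair_sigma_finite M N
    using assms by (simp add: pair_sigma_finite_def)
  have [measurable]: "K \<in> borel_measurable (M \<Otimes>\<^sub>M N)"
    using K by (simp add: sq_integrable_def)
  have int: "integrable (M \<Otimes>\<^sub>M N) (\<lambda>(x, y). (cmod (K (x, y)))\<^sup>2)"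
    using K by (simp add: sq_integrable_def case_prod_unfold)
  show "integrable N (\<lambda>y. (l2norm M (\<lambda>x. K (x, y)))\<^sup>2)"
    unfolding l2norm_power2 using int by (rule integrable_snd)
  show "AE y in N. sq_integrable M (\<lambda>x. K (x, y))"
    using AE_integrable_snd[OF int] AE_space
    by eventually_elim (auto simp: sq_integrable_def)
qed

lemma kernel_operator:
  assumes "sigma_finite_measure M" "sigma_finite_measure N"
    and K: "sq_integrable (M \<Otimes>\<^sub>M N) K" and f: "sq_integrable M f"
  shows "sq_integrable N (\<lambda>y. LINT x|M. f x * K (x, y))"
    and "\<And>g. sq_integrable N g \<Longrightarrow>
      (LINT p|(M \<Otimes>\<^sub>M N). f (fst p) * g (snd p) * K p) = (LINT y|N. g y * (LINT x|M. f x * K (x, y)))"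
proof -
  interpret pair_sigma_finite M N
    using assms by (simp add: pair_sigma_finite_def)
  have [measurable]: "K \<in> borel_measurable (M \<Otimes>\<^sub>M N)" "f \<in> borel_measurable M"
    using K f by (auto simp: sq_integrable_def)
  let ?W = "\<lambda>y. LINT x|M. f x * K (x, y)"
  have W[measurable]: "?W \<in> borel_measurable N"
    by measurable
  have "AE y in N. (cmod (?W y))\<^sup>2 \<le> (l2norm M f)\<^sup>2 * (l2norm M (\<lambda>x. K (x, y)))\<^sup>2"
    using sq_integrable_kernel_slice(1)[OF assms(1,2) K]
  proof eventually_elim
    case (elim y)
    show ?case
      using power_mono[OF Cauchy_Schwarz_integral[OF f elim], of 2] by (simp add: power_mult_distrib)
  qed
  then have "AE y in N. norm ((cmod (?W y))\<^sup>2) \<le> norm ((l2norm M f)\<^sup>2 * (l2norm M (\<lambda>x. K (x, y)))\<^sup>2)"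
    by simp
  moreover have "integrable N (\<lambda>y. (l2norm M f)\<^sup>2 * (l2norm M (\<lambda>x. K (x, y)))\<^sup>2)"
    using sq_integrable_kernel_slice(2)[OF assms(1,2) K] by (rule integrable_mult_right)
  moreover have "(\<lambda>y. (cmod (?W y))\<^sup>2) \<in> borel_measurable N"
    by measurable
  ultimately have "integrable N (\<lambda>y. (cmod (?W y))\<^sup>2)"
    by (rule Bochner_Integration.integrable_bound[rotated 2])
  then show "sq_integrable N ?W"
    using W by (simp add: sq_integrable_def)
  fix g assume g: "sq_integrable N g"
  have "integrable (M \<Otimes>\<^sub>M N) (\<lambda>p. f (fst p) * g (snd p) * K p)"
    by (intro integrable_mult_sq_integrable K sq_integrable_tensor(1)[OF assms(2) f g])
  then have "integrable (M \<Otimes>\<^sub>M N) (\<lambda>(x, y). f x * g y * K (x, y))"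
    by (simp add: case_prod_unfold)
  from integral_snd[OF this]
  have "(LINT p|(M \<Otimes>\<^sub>M N). f (fst p) * g (snd p) * K p) = (LINT y|N. LINT x|M. f x * g y * K (x, y))"
    by (simp add: case_prod_unfold)
  also have "\<dots> = (LINT y|N. g y * ?W y)"
  proof (rule Bochner_Integration.integral_cong[OF refl])
    fix y
    have "(LINT x|M. f x * g y * K (x, y)) = (LINT x|M. g y * (f x * K (x, y)))"
      by (simp add: mult_ac)
    then show "(LINT x|M. f x * g y * K (x, y)) = g y * ?W y"
      by simp
  qed
  finally show "(LINT p|(M \<Otimes>\<^sub>M N). f (fst p) * g (snd p) * K p) = (LINT y|N. g y * ?W y)" .
qed

text \<open>
  A Hilbert--Schmidt operator is compact: it maps \<open>u n\<close> to a sequence that converges pointwise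
  almost everywhere, with a fixed square-integrable majorant, hence in norm.  The pairing of a
  strongly with a weakly convergent sequence converges.
\<close>

lemma weakly_conv_kernel:
  assumes "sigma_finite_measure M" "sigma_finite_measure N"
    and K: "sq_integrable (M \<Otimes>\<^sub>M N) K"
    and u: "weakly_conv M u u'" and w: "weakly_conv N w w'"
  shows "(\<lambda>n. LINT p|(M \<Otimes>\<^sub>M N). u n (fst p) * w n (snd p) * K p)
           \<longlonglongrightarrow> (LINT p|(M \<Otimes>\<^sub>M N). u' (fst p) * w' (snd p) * K p)"
proof -
  have un: "sq_integrable M (u n)" and u': "sq_integrable M u'"
    and wn: "sq_integrable N (w n)" and w': "sq_integrable N w'" for n
    using u w by (auto simp: weakly_conv_def)
  obtain C where C: "\<And>n. l2norm M (u n) \<le> C" "0 \<le> C"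
    using weakly_conv_imp_bounded[OF u] by blast
  obtain D where D: "\<And>n. l2norm N (w n) \<le> D" "0 \<le> D"
    using weakly_conv_imp_bounded[OF w] by blast
  define W where "W f y = (LINT x|M. f x * K (x, y))" for f y
  have W: "sq_integrable N (W f)" if "sq_integrable M f" for f
    using kernel_operator(1)[OF assms(1-3) that] by (simp add: W_def[abs_def])
  let ?k = "\<lambda>y. l2norm M (\<lambda>x. K (x, y))"
  have W_le: "AE y in N. cmod (W f y) \<le> l2norm M f * ?k y" if "sq_integrable M f" for f
    using sq_integrable_kernel_slice(1)[OF assms(1-3)]
    by eventually_elim (simp add: W_def Cauchy_Schwarz_integral that)
  let ?e = "\<lambda>n. l2norm N (\<lambda>y. W (u n) y - W u' y)"
  have "(\<lambda>n. (?e n)\<^sup>2) \<longlonglongrightarrow> (LINT y|N. 0)"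
    unfolding l2norm_power2
  proof (rule integral_dominated_convergence)
    show "integrable N (\<lambda>y. (C + l2norm M u')\<^sup>2 * (?k y)\<^sup>2)"
      using sq_integrable_kernel_slice(2)[OF assms(1-3)] by simp
    show "(\<lambda>y. (cmod (W (u n) y - W u' y))\<^sup>2) \<in> borel_measurable N" for n
      by (intro borel_measurable_integrable sq_integrable_integrable sq_integrable_diff W un u')
    show "AE y in N. (\<lambda>n. (cmod (W (u n) y - W u' y))\<^sup>2) \<longlonglongrightarrow> 0"
      using sq_integrable_kernel_slice(1)[OF assms(1-3)]
    proof eventually_elim
      case (elim y)
      then have "(\<lambda>n. W (u n) y) \<longlonglongrightarrow> W u' y"
        using u by (simp add: weakly_conv_def W_def)
      then show ?case
        using tendsto_power[OF tendsto_norm[OF LIM_zero], of _ "W u' y" sequentially 2] by simp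
    qed
    show "AE y in N. norm ((cmod (W (u n) y - W u' y))\<^sup>2) \<le> (C + l2norm M u')\<^sup>2 * (?k y)\<^sup>2" for n
      using W_le[OF un[of n]] W_le[OF u']
    proof eventually_elim
      case (elim y)
      have "cmod (W (u n) y - W u' y) \<le> cmod (W (u n) y) + cmod (W u' y)"
        by (rule norm_triangle_ineq4)
      also have "\<dots> \<le> C * ?k y + l2norm M u' * ?k y"
        using elim mult_right_mono[OF C(1)[of n], of "?k y"] by simp
      finally have "cmod (W (u n) y - W u' y) \<le> (C + l2norm M u') * ?k y"
        by (simp add: distrib_right)
      then show ?case
        using power_mono[of "cmod (W (u n) y - W u' y)" "(C + l2norm M u') * ?k y" 2]
        by (simp add: power_mult_distrib)
    qed
  qed simp
  then have "(\<lambda>n. sqrt ((?e n)\<^sup>2)) \<longlonglongrightarrow> sqrt 0"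
    by (intro tendsto_real_sqrt) simp
  then have "?e \<longlonglongrightarrow> 0" by simp
  then have e0: "(\<lambda>n. D * ?e n) \<longlonglongrightarrow> 0"
    by (rule tendsto_mult_right_zero)
  have "(\<lambda>n. LINT y|N. w n y * (W (u n) y - W u' y)) \<longlonglongrightarrow> 0"
  proof (rule Lim_null_comparison[OF _ e0], rule always_eventually, rule allI)
    fix n
    have "cmod (LINT y|N. w n y * (W (u n) y - W u' y)) \<le> l2norm N (w n) * ?e n"
      by (intro Cauchy_Schwarz_integral wn sq_integrable_diff W un u')
    also have "\<dots> \<le> D * ?e n"
      by (intro mult_right_mono D) simp
    finally show "cmod (LINT y|N. w n y * (W (u n) y - W u' y)) \<le> D * ?e n" .
  qed
  moreover have "(\<lambda>n. LINT y|N. w n y * W u' y) \<longlonglongrightarrow> (LINT y|N. w' y * W u' y)"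
    using w W[OF u'] by (simp add: weakly_conv_def)
  ultimately have "(\<lambda>n. (LINT y|N. w n y * (W (u n) y - W u' y)) + (LINT y|N. w n y * W u' y))
      \<longlonglongrightarrow> 0 + (LINT y|N. w' y * W u' y)"
    by (rule tendsto_add)
  moreover have "(LINT y|N. w n y * (W (u n) y - W u' y)) + (LINT y|N. w n y * W u' y)
      = (LINT y|N. w n y * W (u n) y)" for n
    using integrable_mult_sq_integrable[OF wn W[OF un]] integrable_mult_sq_integrable[OF wn W[OF u']]
    by (simp add: right_diff_distrib)
  ultimately show ?thesis
    using kernel_operator(2)[OF assms(1-3)] un u' wn w' by (simp add: W_def)
qed

section \<open>Averages of functions that become orthogonal\<close>

text \<open>
  Everything here is Fubini's theorem: the Cauchy--Schwarz inequality in \<open>X\<close> bounds the inner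
  integrals uniformly in the parameters, and the parameter measure is finite.  Absolute integrability
  of the products \<open>q l * cnj (q m)\<close> over \<open>(L \<Otimes>\<^sub>M L) \<Otimes>\<^sub>M X\<close> also yields that the average is square
  integrable.
\<close>

lemma average_sq_integrable:
  fixes q :: "'l \<Rightarrow> 'z \<Rightarrow> complex"
  assumes "finite_measure L" "sigma_finite_measure X"
    and q[measurable]: "case_prod q \<in> borel_measurable (L \<Otimes>\<^sub>M X)"
    and sq: "\<And>l. l \<in> space L \<Longrightarrow> sq_integrable X (q l)"
    and bound: "\<And>l. l \<in> space L \<Longrightarrow> l2norm X (q l) \<le> C"
  defines "A \<equiv> \<lambda>z. LINT l|L. q l z"
  shows "sq_integrable X A"
    and "complex_of_real ((l2norm X A)\<^sup>2) = (LINT s|(L \<Otimes>\<^sub>M L). LINT z|X. q (fst s) z * cnj (q (snd s) z))"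
    and "\<And>y. sq_integrable X y \<Longrightarrow> (LINT l|L. LINT z|X. y z * q l z) = (LINT z|X. y z * A z)"
    and "\<And>y. sq_integrable X y \<Longrightarrow> integrable L (\<lambda>l. LINT z|X. y z * q l z)"
proof -
  interpret L: finite_measure L by fact
  interpret X: sigma_finite_measure X by fact
  interpret LX: pair_sigma_finite L X
    by (simp add: pair_sigma_finite_def L.sigma_finite_measure_axioms X.sigma_finite_measure_axioms)
  interpret LL: pair_sigma_finite L L
    by (simp add: pair_sigma_finite_def L.sigma_finite_measure_axioms)
  interpret LLf: finite_measure "L \<Otimes>\<^sub>M L"
    by (rule finite_measure_pair_measure) fact+
  interpret LLX: pair_sigma_finite "L \<Otimes>\<^sub>M L" X
    using LLf.finite_measure_axioms
    by (simp add: pair_sigma_finite_def finite_measure_def X.sigma_finite_measure_axioms)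
  have qm[measurable (raw)]: "(\<lambda>x. q (a x) (b x)) \<in> borel_measurable T"
    if "a \<in> measurable T L" "b \<in> measurable T X" for a b T
    using measurable_compose[OF measurable_Pair[OF that] q] by simp
  have [measurable (raw)]: "(\<lambda>x. cnj (q (a x) (b x))) \<in> borel_measurable T"
    if "a \<in> measurable T L" "b \<in> measurable T X" for a b T
    using measurable_compose[OF qm[OF that] borel_measurable_cnj] by simp
  have A[measurable]: "A \<in> borel_measurable X"
    unfolding A_def by measurable
  let ?\<theta> = "\<lambda>s z. q (fst s) z * cnj (q (snd s) z)"
  have cs: "(LINT z|X. cmod (?\<theta> s z)) \<le> C\<^sup>2" if "s \<in> space (L \<Otimes>\<^sub>M L)" for s
  proof -
    have s: "fst s \<in> space L" "snd s \<in> space L"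
      using that by (auto simp: space_pair_measure)
    have "(LINT z|X. cmod (?\<theta> s z)) \<le> l2norm X (q (fst s)) * l2norm X (\<lambda>z. cnj (q (snd s) z))"
      by (intro Cauchy_Schwarz_norm sq sq_integrable_cnj s)
    also have "\<dots> \<le> C * C"
      using bound s order_trans[OF l2norm_nonneg bound[OF s(1)]]
      by (simp add: mult_mono)
    finally show ?thesis by (simp add: power2_eq_square)
  qed
  have \<theta>_int: "integrable ((L \<Otimes>\<^sub>M L) \<Otimes>\<^sub>M X) (case_prod ?\<theta>)"
  proof (rule LLX.Fubini_integrable)
    show "case_prod ?\<theta> \<in> borel_measurable ((L \<Otimes>\<^sub>M L) \<Otimes>\<^sub>M X)"
      by measurable
    show "integrable (L \<Otimes>\<^sub>M L) (\<lambda>s. LINT z|X. norm (case_prod ?\<theta> (s, z)))"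
      by (rule LLf.integrable_const_bound[of _ "C\<^sup>2"])
         (use cs in \<open>auto intro!: AE_I2 simp: integral_nonneg_AE\<close>)
    show "AE s in (L \<Otimes>\<^sub>M L). integrable X (\<lambda>z. case_prod ?\<theta> (s, z))"
      by (intro AE_I2) (auto simp: space_pair_measure intro!: integrable_mult_sq_integrable sq sq_integrable_cnj)
  qed
  have "AE z in X. (LINT s|(L \<Otimes>\<^sub>M L). ?\<theta> s z) = A z * cnj (A z)"
    using LLX.AE_integrable_snd[OF \<theta>_int] AE_space
  proof eventually_elim
    case (elim z)
    have "integrable (L \<Otimes>\<^sub>M L) (\<lambda>(l, m). q l z * cnj (q m z))"
      using elim(1) by (simp add: case_prod_unfold)
    from LL.integral_fst[OF this] show ?case
      by (simp add: A_def case_prod_unfold)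
  qed
  then have sqA: "AE z in X. (LINT s|(L \<Otimes>\<^sub>M L). ?\<theta> s z) = complex_of_real ((cmod (A z))\<^sup>2)"
    by (simp add: complex_norm_square del: of_real_power)
  have "integrable X (\<lambda>z. complex_of_real ((cmod (A z))\<^sup>2))"
    by (rule integrable_cong_AE_imp[OF LLX.integrable_snd[OF \<theta>_int]]) (use sqA in auto)
  then have "integrable X (\<lambda>z. (cmod (A z))\<^sup>2)"
    by (simp only: complex_of_real_integrable_eq)
  then show "sq_integrable X A"
    by (simp add: sq_integrable_def)
  have "complex_of_real ((l2norm X A)\<^sup>2) = (LINT z|X. complex_of_real ((cmod (A z))\<^sup>2))"
    by (simp add: l2norm_power2 del: of_real_power)
  also have "\<dots> = (LINT z|X. LINT s|(L \<Otimes>\<^sub>M L). ?\<theta> s z)"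
    by (rule integral_cong_AE) (use sqA in auto)
  also have "\<dots> = (LINT s|(L \<Otimes>\<^sub>M L). LINT z|X. ?\<theta> s z)"
    by (rule LLX.Fubini_integral[OF \<theta>_int])
  finally show "complex_of_real ((l2norm X A)\<^sup>2) = (LINT s|(L \<Otimes>\<^sub>M L). LINT z|X. ?\<theta> s z)" .
  fix y assume y: "sq_integrable X y"
  have [measurable]: "y \<in> borel_measurable X"
    using y by (simp add: sq_integrable_def)
  have int: "integrable (L \<Otimes>\<^sub>M X) (\<lambda>(l, z). y z * q l z)"
  proof (rule LX.Fubini_integrable)
    have "(LINT z|X. cmod (y z * q l z)) \<le> l2norm X y * C" if "l \<in> space L" for l
      using order_trans[OF Cauchy_Schwarz_norm[OF y sq[OF that]] mult_left_mono[OF bound[OF that]]]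
      by simp
    then show "integrable L (\<lambda>l. LINT z|X. norm (case_prod (\<lambda>l z. y z * q l z) (l, z)))"
      by (intro L.integrable_const_bound[of _ "l2norm X y * C"])
         (auto intro!: AE_I2 simp: integral_nonneg_AE)
    show "AE l in L. integrable X (\<lambda>z. case_prod (\<lambda>l z. y z * q l z) (l, z))"
      by (intro AE_I2) (auto intro!: integrable_mult_sq_integrable y sq)
  qed measurable
  show "integrable L (\<lambda>l. LINT z|X. y z * q l z)"
    using LX.integrable_fst[OF int] .
  show "(LINT l|L. LINT z|X. y z * q l z) = (LINT z|X. y z * A z)"
    using LX.Fubini_integral[OF int] by (simp add: A_def)
qed

text \<open>
  The squared norm of an average is the average of all mutual inner products, so it tends to zero if
  the functions at almost all pairs of parameters become orthogonal, by dominated convergence.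
\<close>

lemma average_tendsto_0:
  fixes q :: "nat \<Rightarrow> 'l \<Rightarrow> 'z \<Rightarrow> complex"
  assumes "finite_measure L" "sigma_finite_measure X"
    and q: "\<And>n. case_prod (q n) \<in> borel_measurable (L \<Otimes>\<^sub>M X)"
    and sq: "\<And>n l. l \<in> space L \<Longrightarrow> sq_integrable X (q n l)"
    and bound: "\<And>n l. l \<in> space L \<Longrightarrow> l2norm X (q n l) \<le> C"
    and orth: "AE s in (L \<Otimes>\<^sub>M L). (\<lambda>n. LINT z|X. q n (fst s) z * cnj (q n (snd s) z)) \<longlonglongrightarrow> 0"
  shows "(\<lambda>n. l2norm X (\<lambda>z. LINT l|L. q n l z)) \<longlonglongrightarrow> 0"
proof -
  interpret L: finite_measure L by fact
  interpret X: sigma_finite_measure X by fact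
  interpret LL: finite_measure "L \<Otimes>\<^sub>M L"
    by (rule finite_measure_pair_measure) fact+
  have qm[measurable (raw)]: "(\<lambda>x. q n (a x) (b x)) \<in> borel_measurable T"
    if "a \<in> measurable T L" "b \<in> measurable T X" for a b T n
    using measurable_compose[OF measurable_Pair[OF that] q[of n]] by simp
  have [measurable (raw)]: "(\<lambda>x. cnj (q n (a x) (b x))) \<in> borel_measurable T"
    if "a \<in> measurable T L" "b \<in> measurable T X" for a b T n
    using measurable_compose[OF qm[OF that] borel_measurable_cnj] by simp
  let ?N = "\<lambda>n. l2norm X (\<lambda>z. LINT l|L. q n l z)"
  have "(\<lambda>n. LINT s|(L \<Otimes>\<^sub>M L). LINT z|X. q n (fst s) z * cnj (q n (snd s) z)) \<longlonglongrightarrow> (LINT s|(L \<Otimes>\<^sub>M L). 0)"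
  proof (rule integral_dominated_convergence[OF _ _ _ orth])
    show "integrable (L \<Otimes>\<^sub>M L) (\<lambda>_. C\<^sup>2)" by simp
    show "AE s in (L \<Otimes>\<^sub>M L). norm (LINT z|X. q n (fst s) z * cnj (q n (snd s) z)) \<le> C\<^sup>2" for n
    proof (rule AE_I2)
      fix s assume "s \<in> space (L \<Otimes>\<^sub>M L)"
      then have s: "fst s \<in> space L" "snd s \<in> space L"
        by (auto simp: space_pair_measure)
      have "norm (LINT z|X. q n (fst s) z * cnj (q n (snd s) z))
          \<le> l2norm X (q n (fst s)) * l2norm X (\<lambda>z. cnj (q n (snd s) z))"
        by (intro Cauchy_Schwarz_integral sq sq_integrable_cnj s)
      also have "\<dots> \<le> C * C"
        using bound s order_trans[OF l2norm_nonneg bound[OF s(1)]]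
        by (simp add: mult_mono)
      finally show "norm (LINT z|X. q n (fst s) z * cnj (q n (snd s) z)) \<le> C\<^sup>2"
        by (simp add: power2_eq_square)
    qed
  qed measurable
  then have "(\<lambda>n. complex_of_real ((?N n)\<^sup>2)) \<longlonglongrightarrow> complex_of_real 0"
    using average_sq_integrable(2)[OF assms(1,2) q sq bound] by simp
  then have "(\<lambda>n. (?N n)\<^sup>2) \<longlonglongrightarrow> 0"
    by (simp only: tendsto_of_real_iff)
  then have "(\<lambda>n. sqrt ((?N n)\<^sup>2)) \<longlonglongrightarrow> sqrt 0"
    by (rule tendsto_real_sqrt)
  then show ?thesis by simp
qed

section \<open>Changes of variables in the plane\<close>

lemma perp_nth [simp]: "perp x $ 1 = - (x $ 2)" "perp x $ 2 = x $ 1"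
  by (simp_all add: perp_def)

lemma perp_add: "perp (x + y) = perp x + perp y"
  and perp_diff: "perp (x - y) = perp x - perp y"
  and perp_scaleR: "perp (c *\<^sub>R x) = c *\<^sub>R perp x"
  and perp_perp: "perp (perp x) = - x"
  by (simp_all add: vec_eq_iff forall_2)

lemma linear_perp: "linear perp"
  by (rule linearI) (simp_all add: perp_add perp_scaleR)

lemma borel_measurable_perp [measurable]: "perp \<in> borel_measurable borel"
  by (intro borel_measurable_continuous_onI linear_continuous_on linear_conv_bounded_linear[THEN iffD1] linear_perp)

lemma prod_Basis_real2: "(\<Prod>b\<in>Basis. (v::real^2) \<bullet> b) = v $ 1 * v $ 2"
proof -
  have B: "(Basis :: (real^2) set) = {axis 1 1, axis 2 1}"
    by (auto simp: Basis_vec_def UNIV_2)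
  show ?thesis
    unfolding B by (simp add: axis_eq_axis inner_axis)
qed

text \<open>A quarter turn permutes the boxes up to swapping their side lengths.\<close>

lemma lborel_distr_perp: "distr lborel borel perp = lborel"
proof (rule lborel_eqI[symmetric])
  fix l u :: "real^2"
  assume le: "\<And>b. b \<in> Basis \<Longrightarrow> l \<bullet> b \<le> u \<bullet> b"
  have le': "l $ i \<le> u $ i" for i
    using le[of "axis i 1"] by (simp add: inner_axis axis_in_Basis_iff)
  have box: "perp -` box l u = box (vector [l $ 2, - (u $ 1)]) (vector [u $ 2, - (l $ 1)])"
    by (auto simp: mem_box_cart forall_2)
  have "emeasure (distr lborel borel perp) (box l u) = emeasure lborel (perp -` box l u)"
    by (subst emeasure_distr) auto
  also have "\<dots> = (\<Prod>b\<in>Basis. (vector [u $ 2, - (l $ 1)] - vector [l $ 2, - (u $ 1)] :: real^2) \<bullet> b)"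
    unfolding box
    by (rule emeasure_lborel_box)
       (use le' in \<open>auto simp: Basis_vec_def inner_axis UNIV_2\<close>)
  also have "\<dots> = (\<Prod>b\<in>Basis. (u - l) \<bullet> b)"
    unfolding prod_Basis_real2 by (simp add: mult.commute)
  finally show "emeasure (distr lborel borel perp) (box l u) = (\<Prod>b\<in>Basis. (u - l) \<bullet> b)" .
qed simp

lemma nn_integral_perp:
  assumes [measurable]: "\<phi> \<in> borel_measurable borel"
  shows "(\<integral>\<^sup>+x. \<phi> (perp x) \<partial>lborel) = (\<integral>\<^sup>+x. \<phi> x \<partial>lborel)"
  by (subst (2) lborel_distr_perp[symmetric]) (simp add: nn_integral_distr)

lemma nn_integral_shift:
  fixes \<phi> :: "real^2 \<Rightarrow> ennreal"
  assumes [measurable]: "\<phi> \<in> borel_measurable borel"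
  shows "(\<integral>\<^sup>+x. \<phi> (c + x) \<partial>lborel) = (\<integral>\<^sup>+x. \<phi> x \<partial>lborel)"
  by (subst (2) lborel_distr_plus[of c, symmetric]) (simp add: nn_integral_distr)

lemma nn_integral_scaled_perp:
  fixes \<phi> :: "real^2 \<Rightarrow> ennreal"
  assumes [measurable]: "\<phi> \<in> borel_measurable borel" and r: "r \<noteq> 0"
  shows "(\<integral>\<^sup>+x. \<phi> (c + r *\<^sub>R perp x) \<partial>lborel) = ennreal (1 / r\<^sup>2) * (\<integral>\<^sup>+x. \<phi> x \<partial>lborel)"
proof -
  have "(\<integral>\<^sup>+x. \<phi> x \<partial>lborel) = (\<integral>\<^sup>+x. ennreal (r\<^sup>2) * \<phi> (c + r *\<^sub>R x) \<partial>lborel)"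
    by (subst lborel_affine[OF r, of c])
       (simp add: nn_integral_density nn_integral_distr)
  also have "\<dots> = ennreal (r\<^sup>2) * (\<integral>\<^sup>+x. \<phi> (c + r *\<^sub>R perp x) \<partial>lborel)"
    by (subst nn_integral_cmult) (auto simp: nn_integral_perp[of "\<lambda>x. \<phi> (c + r *\<^sub>R x)"])
  finally show ?thesis
    using r by (simp add: mult.assoc[symmetric] ennreal_mult[symmetric])
qed

abbreviation plane2 :: "((real^2) \<times> (real^2)) measure" where
  "plane2 \<equiv> lborel \<Otimes>\<^sub>M lborel"

lemma sigma_finite_plane2: "sigma_finite_measure plane2"
  unfolding lborel_prod by (rule sigma_finite_lborel)

text \<open>
  A rectangle with corners \<open>a = \<xi> + x\<close>, \<open>b = \<xi> + x + l x\<^sup>\<bottom>\<close>, \<open>c = \<xi> + l x\<^sup>\<bottom>\<close> and \<open>d = \<xi>\<close> is determined by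
  the ratio \<open>l\<close> and by its edge \<open>p = (b, c)\<close>: then \<open>x = b - c\<close>, and the functions below give the two
  corners of the opposite edge.
\<close>

definition corner_a :: "real \<Rightarrow> (real^2) \<times> (real^2) \<Rightarrow> real^2" where
  "corner_a l p = fst p - l *\<^sub>R perp (fst p - snd p)"

definition corner_d :: "real \<Rightarrow> (real^2) \<times> (real^2) \<Rightarrow> real^2" where
  "corner_d l p = snd p - l *\<^sub>R perp (fst p - snd p)"

lemma measurable_corners [measurable (raw)]:
  assumes [measurable]: "a \<in> borel_measurable T" and b: "b \<in> measurable T plane2"
  shows "(\<lambda>x. corner_a (a x) (b x)) \<in> borel_measurable T"
    and "(\<lambda>x. corner_d (a x) (b x)) \<in> borel_measurable T"
proof -
  have [measurable]: "(\<lambda>x. fst (b x)) \<in> borel_measurable T" "(\<lambda>x. snd (b x)) \<in> borel_measurable T"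
    using measurable_compose[OF b measurable_fst] measurable_compose[OF b measurable_snd] by auto
  show "(\<lambda>x. corner_a (a x) (b x)) \<in> borel_measurable T"
    and "(\<lambda>x. corner_d (a x) (b x)) \<in> borel_measurable T"
    unfolding corner_a_def corner_d_def by measurable
qed

lemma nn_integral_plane2:
  assumes [measurable]: "\<phi> \<in> borel_measurable plane2"
  shows "(\<integral>\<^sup>+p. \<phi> p \<partial>plane2) = (\<integral>\<^sup>+x. \<integral>\<^sup>+y. \<phi> (x, y) \<partial>lborel \<partial>lborel)"
    and "(\<integral>\<^sup>+p. \<phi> p \<partial>plane2) = (\<integral>\<^sup>+y. \<integral>\<^sup>+x. \<phi> (x, y) \<partial>lborel \<partial>lborel)"
  by (simp_all add: lborel.nn_integral_fst lborel_pair.nn_integral_snd)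

text \<open>
  In the integral over \<open>(\<xi>, x)\<close>, the two corners \<open>\<xi> + x + l x\<^sup>\<bottom>\<close> and \<open>\<xi> + l x\<^sup>\<bottom>\<close> are adjacent, so
  passing to them as variables is a composition of two shears.
\<close>

lemma nn_integral_edge:
  assumes [measurable]: "\<phi> \<in> borel_measurable plane2"
  shows "(\<integral>\<^sup>+p. \<phi> (corner_d l p, fst p - snd p) \<partial>plane2) = (\<integral>\<^sup>+p. \<phi> p \<partial>plane2)"
proof -
  have "(\<integral>\<^sup>+p. \<phi> (corner_d l p, fst p - snd p) \<partial>plane2)
      = (\<integral>\<^sup>+c. \<integral>\<^sup>+b. \<phi> (c - l *\<^sub>R perp (b - c), b - c) \<partial>lborel \<partial>lborel)"
    by (subst nn_integral_plane2(2)) (auto simp: corner_d_def)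
  also have "\<dots> = (\<integral>\<^sup>+c. \<integral>\<^sup>+x. \<phi> (c - l *\<^sub>R perp x, x) \<partial>lborel \<partial>lborel)"
  proof (rule nn_integral_cong)
    fix c :: "real^2"
    show "(\<integral>\<^sup>+b. \<phi> (c - l *\<^sub>R perp (b - c), b - c) \<partial>lborel) = (\<integral>\<^sup>+x. \<phi> (c - l *\<^sub>R perp x, x) \<partial>lborel)"
      using nn_integral_shift[of "\<lambda>x. \<phi> (c - l *\<^sub>R perp x, x)" "- c"] by simp
  qed
  also have "\<dots> = (\<integral>\<^sup>+x. \<integral>\<^sup>+c. \<phi> (c - l *\<^sub>R perp x, x) \<partial>lborel \<partial>lborel)"
    by (rule lborel_pair.Fubini') measurable
  also have "\<dots> = (\<integral>\<^sup>+x. \<integral>\<^sup>+d. \<phi> (d, x) \<partial>lborel \<partial>lborel)"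
  proof (rule nn_integral_cong)
    fix x :: "real^2"
    show "(\<integral>\<^sup>+c. \<phi> (c - l *\<^sub>R perp x, x) \<partial>lborel) = (\<integral>\<^sup>+d. \<phi> (d, x) \<partial>lborel)"
      using nn_integral_shift[of "\<lambda>d. \<phi> (d, x)" "- (l *\<^sub>R perp x)"] by simp
  qed
  also have "\<dots> = (\<integral>\<^sup>+p. \<phi> p \<partial>plane2)"
    by (rule nn_integral_plane2(2)[symmetric]) simp
  finally show ?thesis .
qed

lemma nn_integral_corners:
  assumes [measurable]: "\<phi> \<in> borel_measurable plane2"
  shows "(\<integral>\<^sup>+p. \<phi> (corner_a l p, corner_d l p) \<partial>plane2) = (\<integral>\<^sup>+p. \<phi> p \<partial>plane2)"
proof -
  have "(\<integral>\<^sup>+p. \<phi> (corner_a l p, corner_d l p) \<partial>plane2)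
      = (\<integral>\<^sup>+p. (\<lambda>(d, x). \<phi> (d + x, d)) (corner_d l p, fst p - snd p) \<partial>plane2)"
    by (simp add: corner_a_def corner_d_def)
  also have "\<dots> = (\<integral>\<^sup>+p. (\<lambda>(d, x). \<phi> (d + x, d)) p \<partial>plane2)"
    by (rule nn_integral_edge) measurable
  also have "\<dots> = (\<integral>\<^sup>+d. \<integral>\<^sup>+x. \<phi> (d + x, d) \<partial>lborel \<partial>lborel)"
    by (subst nn_integral_plane2(1)) auto
  also have "\<dots> = (\<integral>\<^sup>+d. \<integral>\<^sup>+a. \<phi> (a, d) \<partial>lborel \<partial>lborel)"
    by (intro nn_integral_cong nn_integral_shift) measurable
  also have "\<dots> = (\<integral>\<^sup>+p. \<phi> p \<partial>plane2)"
    by (rule nn_integral_plane2(2)[symmetric]) simp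
  finally show ?thesis .
qed

text \<open>
  For two different parameters the two corners \<open>a\<close> over the same edge are independent variables:
  they differ by \<open>(m - l) (b - c)\<^sup>\<bottom>\<close>.  This is where the average over the parameter enters.
\<close>

lemma nn_integral_two_corners_a:
  assumes [measurable]: "\<phi> \<in> borel_measurable plane2" and "l \<noteq> m"
  shows "(\<integral>\<^sup>+p. \<phi> (corner_a l p, corner_a m p) \<partial>plane2) = ennreal (1 / (l - m)\<^sup>2) * (\<integral>\<^sup>+p. \<phi> p \<partial>plane2)"
proof -
  have "(\<integral>\<^sup>+p. \<phi> (corner_a l p, corner_a m p) \<partial>plane2)
      = (\<integral>\<^sup>+b. \<integral>\<^sup>+c. \<phi> (b - l *\<^sub>R perp (b - c), b - m *\<^sub>R perp (b - c)) \<partial>lborel \<partial>lborel)"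
    by (subst nn_integral_plane2(1)) (auto simp: corner_a_def)
  also have "\<dots> = (\<integral>\<^sup>+b. \<integral>\<^sup>+x. \<phi> (b + l *\<^sub>R perp x, b + m *\<^sub>R perp x) \<partial>lborel \<partial>lborel)"
  proof (rule nn_integral_cong)
    fix b :: "real^2"
    show "(\<integral>\<^sup>+c. \<phi> (b - l *\<^sub>R perp (b - c), b - m *\<^sub>R perp (b - c)) \<partial>lborel)
        = (\<integral>\<^sup>+x. \<phi> (b + l *\<^sub>R perp x, b + m *\<^sub>R perp x) \<partial>lborel)"
      using nn_integral_shift[of "\<lambda>x. \<phi> (b + l *\<^sub>R perp x, b + m *\<^sub>R perp x)" "- b"]
      by (simp add: perp_diff perp_add algebra_simps)
  qed
  also have "\<dots> = (\<integral>\<^sup>+x. \<integral>\<^sup>+b. \<phi> (b + l *\<^sub>R perp x, b + m *\<^sub>R perp x) \<partial>lborel \<partial>lborel)"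
    by (rule lborel_pair.Fubini') measurable
  also have "\<dots> = (\<integral>\<^sup>+x. \<integral>\<^sup>+u. \<phi> (u, u + (m - l) *\<^sub>R perp x) \<partial>lborel \<partial>lborel)"
  proof (rule nn_integral_cong)
    fix x :: "real^2"
    show "(\<integral>\<^sup>+b. \<phi> (b + l *\<^sub>R perp x, b + m *\<^sub>R perp x) \<partial>lborel)
        = (\<integral>\<^sup>+u. \<phi> (u, u + (m - l) *\<^sub>R perp x) \<partial>lborel)"
      using nn_integral_shift[of "\<lambda>u. \<phi> (u, u + (m - l) *\<^sub>R perp x)" "l *\<^sub>R perp x"]
      by (simp add: algebra_simps)
  qed
  also have "\<dots> = (\<integral>\<^sup>+u. \<integral>\<^sup>+x. \<phi> (u, u + (m - l) *\<^sub>R perp x) \<partial>lborel \<partial>lborel)"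
    by (rule lborel_pair.Fubini') measurable
  also have "\<dots> = (\<integral>\<^sup>+u. ennreal (1 / (m - l)\<^sup>2) * (\<integral>\<^sup>+v. \<phi> (u, v) \<partial>lborel) \<partial>lborel)"
    using \<open>l \<noteq> m\<close> by (intro nn_integral_cong nn_integral_scaled_perp) auto
  also have "\<dots> = ennreal (1 / (m - l)\<^sup>2) * (\<integral>\<^sup>+p. \<phi> p \<partial>plane2)"
    by (subst nn_integral_cmult) (auto simp: nn_integral_plane2(1))
  finally show ?thesis
    by (simp add: power2_commute)
qed

lemma nn_integral_two_corners_d:
  assumes [measurable]: "\<phi> \<in> borel_measurable plane2" and "l \<noteq> m"
  shows "(\<integral>\<^sup>+p. \<phi> (corner_d l p, corner_d m p) \<partial>plane2) = ennreal (1 / (l - m)\<^sup>2) * (\<integral>\<^sup>+p. \<phi> p \<partial>plane2)"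
proof -
  have "(\<integral>\<^sup>+p. \<phi> (corner_d l p, corner_d m p) \<partial>plane2)
      = (\<integral>\<^sup>+c. \<integral>\<^sup>+b. \<phi> (corner_d l (b, c), corner_d m (b, c)) \<partial>lborel \<partial>lborel)"
    by (rule nn_integral_plane2(2)) measurable
  also have "\<dots> = (\<integral>\<^sup>+c. \<integral>\<^sup>+b. \<phi> (corner_a (- l) (c, b), corner_a (- m) (c, b)) \<partial>lborel \<partial>lborel)"
    by (simp add: corner_a_def corner_d_def perp_diff algebra_simps)
  also have "\<dots> = (\<integral>\<^sup>+p. \<phi> (corner_a (- l) p, corner_a (- m) p) \<partial>plane2)"
    by (rule nn_integral_plane2(1)[symmetric]) measurable
  also have "\<dots> = ennreal (1 / (- l - - m)\<^sup>2) * (\<integral>\<^sup>+p. \<phi> p \<partial>plane2)"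
    by (rule nn_integral_two_corners_a) (use assms in auto)
  finally show ?thesis
    by (simp add: power2_commute)
qed

text \<open>
  A substitution that scales all nonnegative integrals by a constant says that the image measure is
  a multiple of the original one, hence it is also valid for complex integrands, integrable or not.
\<close>

lemma integral_of_nn_integral_transfer:
  fixes \<psi> :: "'a \<Rightarrow> complex"
  assumes T[measurable]: "T \<in> measurable M M" and c: "0 \<le> c"
    and nn: "\<And>\<phi>. \<phi> \<in> borel_measurable M \<Longrightarrow> (\<integral>\<^sup>+p. \<phi> (T p) \<partial>M) = ennreal c * (\<integral>\<^sup>+p. \<phi> p \<partial>M)"
    and \<psi>[measurable]: "\<psi> \<in> borel_measurable M"
  shows "(LINT p|M. \<psi> (T p)) = c *\<^sub>R (LINT p|M. \<psi> p)"
proof -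
  have "distr M M T = density M (\<lambda>_. ennreal c)"
  proof (rule measure_eqI)
    fix A assume "A \<in> sets (distr M M T)"
    then have A[measurable]: "A \<in> sets M" by simp
    have "emeasure (distr M M T) A = (\<integral>\<^sup>+p. indicator A p \<partial>distr M M T)"
      by simp
    also have "\<dots> = (\<integral>\<^sup>+p. indicator A (T p) \<partial>M)"
      by (rule nn_integral_distr) auto
    also have "\<dots> = ennreal c * (\<integral>\<^sup>+p. indicator A p \<partial>M)"
      by (rule nn) simp
    also have "\<dots> = emeasure (density M (\<lambda>_. ennreal c)) A"
      by (simp add: emeasure_density nn_integral_cmult)
    finally show "emeasure (distr M M T) A = emeasure (density M (\<lambda>_. ennreal c)) A" .
  qed simp
  then have "(LINT p|M. \<psi> (T p)) = integral\<^sup>L (density M (\<lambda>_. ennreal c)) \<psi>"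
    using integral_distr[OF T \<psi>] by simp
  also have "\<dots> = c *\<^sub>R (LINT p|M. \<psi> p)"
    using c by (subst integral_density) auto
  finally show ?thesis .
qed

section \<open>Products over the opposite edge of a rectangle\<close>

definition opp_edge_prod ::
    "(real^2 \<Rightarrow> complex) \<Rightarrow> (real^2 \<Rightarrow> complex) \<Rightarrow> real \<Rightarrow> (real^2) \<times> (real^2) \<Rightarrow> complex" where
  "opp_edge_prod f k l p = f (corner_a l p) * cnj (k (corner_d l p))"

lemma sq_integrable_opp_edge_prod:
  assumes f: "sq_integrable lborel f" and k: "sq_integrable lborel k"
  shows "sq_integrable plane2 (opp_edge_prod f k l)"
    and "l2norm plane2 (opp_edge_prod f k l) \<le> l2norm lborel f * l2norm lborel k"
proof -
  have [measurable]: "f \<in> borel_measurable borel" "k \<in> borel_measurable borel"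
    using f k by (auto simp: sq_integrable_def)
  have meas: "opp_edge_prod f k l \<in> borel_measurable plane2"
    unfolding opp_edge_prod_def[abs_def] by measurable
  have t: "sq_integrable plane2 (\<lambda>p. f (fst p) * k (snd p))"
    "l2norm plane2 (\<lambda>p. f (fst p) * k (snd p)) \<le> l2norm lborel f * l2norm lborel k"
    using sq_integrable_tensor[OF sigma_finite_lborel f k] by auto
  have "(\<integral>\<^sup>+p. ennreal ((cmod (opp_edge_prod f k l p))\<^sup>2) \<partial>plane2)
      = (\<integral>\<^sup>+p. (\<lambda>p. ennreal ((cmod (f (fst p) * k (snd p)))\<^sup>2)) (corner_a l p, corner_d l p) \<partial>plane2)"
    by (simp add: opp_edge_prod_def norm_mult)
  also have "\<dots> = (\<integral>\<^sup>+p. ennreal ((cmod (f (fst p) * k (snd p)))\<^sup>2) \<partial>plane2)"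
    by (rule nn_integral_corners) measurable
  also have "\<dots> = ennreal ((l2norm plane2 (\<lambda>p. f (fst p) * k (snd p)))\<^sup>2)"
    by (rule nn_integral_eq_l2norm) (rule t)
  also have "\<dots> \<le> ennreal ((l2norm lborel f * l2norm lborel k)\<^sup>2)"
    by (intro ennreal_leI power_mono t) simp
  finally have "(\<integral>\<^sup>+p. ennreal ((cmod (opp_edge_prod f k l p))\<^sup>2) \<partial>plane2) \<le> ennreal ((l2norm lborel f * l2norm lborel k)\<^sup>2)" .
  note * = sq_integrable_nn_le[OF meas this]
  show "sq_integrable plane2 (opp_edge_prod f k l)"
    by (rule *(1)) simp
  show "l2norm plane2 (opp_edge_prod f k l) \<le> l2norm lborel f * l2norm lborel k"
    by (rule power2_le_imp_le, rule *(2)) auto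
qed

text \<open>
  The inverse of \<open>p \<mapsto> (corner_a l p, corner_a m p)\<close>: with \<open>x\<close> the difference of the end
  points of the edge, the two corners differ by \<open>(m - l) x\<^sup>\<bottom>\<close>, and turning this once more recovers a
  multiple of \<open>x\<close>.
\<close>

definition edge_of_corners :: "real \<Rightarrow> real \<Rightarrow> (real^2) \<times> (real^2) \<Rightarrow> (real^2) \<times> (real^2)" where
  "edge_of_corners l m s =
     (let x = (1 / (l - m)) *\<^sub>R perp (fst s - snd s); b = fst s + l *\<^sub>R perp x in (b, b - x))"

lemma edge_of_corners_inverse:
  assumes "l \<noteq> m"
  shows "edge_of_corners l m (corner_a l p, corner_a m p) = p"
proof -
  let ?x = "fst p - snd p"
  have "corner_a l p - corner_a m p = (m - l) *\<^sub>R perp ?x"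
    by (simp add: corner_a_def algebra_simps)
  then have "perp (corner_a l p - corner_a m p) = (m - l) *\<^sub>R (- ?x)"
    by (simp only: perp_scaleR perp_perp)
  also have "\<dots> = (l - m) *\<^sub>R ?x"
    by (simp add: algebra_simps)
  finally have "(1 / (l - m)) *\<^sub>R perp (corner_a l p - corner_a m p) = ?x"
    using assms by simp
  then show ?thesis
    by (simp add: edge_of_corners_def Let_def corner_a_def)
qed

lemma measurable_edge_of_corners [measurable]: "edge_of_corners l m \<in> measurable plane2 plane2"
  unfolding edge_of_corners_def Let_def by measurable

text \<open>
  With the two corners \<open>a\<close> for the ratios \<open>l\<close> and \<open>m\<close> as variables, the inner product of the two
  products is a bilinear form in \<open>F n\<close> and its conjugate.  Its kernel is made of the values of \<open>k\<close> at
  the two corners \<open>d\<close>, which are independent variables as well, so it is square integrable and the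
  form is of Hilbert--Schmidt type.
\<close>

lemma opp_edge_prod_orthogonal:
  assumes F: "weakly_conv lborel F (\<lambda>_. 0)" and k: "sq_integrable lborel k" and lm: "l \<noteq> m"
  shows "(\<lambda>n. LINT p|plane2. opp_edge_prod (F n) k l p * cnj (opp_edge_prod (F n) k m p)) \<longlonglongrightarrow> 0"
proof -
  have Fn: "sq_integrable lborel (F n)" for n
    using F by (simp add: weakly_conv_def)
  have [measurable]: "k \<in> borel_measurable borel" "F n \<in> borel_measurable borel" for n
    using k Fn[of n] by (auto simp: sq_integrable_def)
  define T where "T p = (corner_a l p, corner_a m p)" for p
  have T[measurable]: "T \<in> measurable plane2 plane2"
    unfolding T_def[abs_def] by measurable
  let ?c = "1 / (l - m)\<^sup>2"
  have nnT: "(\<integral>\<^sup>+p. \<phi> (T p) \<partial>plane2) = ennreal ?c * (\<integral>\<^sup>+p. \<phi> p \<partial>plane2)"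
    if "\<phi> \<in> borel_measurable plane2" for \<phi>
    unfolding T_def using nn_integral_two_corners_a[OF that lm] .
  have inv: "edge_of_corners l m (T p) = p" for p
    unfolding T_def by (rule edge_of_corners_inverse[OF lm])
  define K where "K s = cnj (k (corner_d l (edge_of_corners l m s))) * k (corner_d m (edge_of_corners l m s))" for s
  have K[measurable]: "K \<in> borel_measurable plane2"
    unfolding K_def[abs_def] by measurable
  have "ennreal ?c * (\<integral>\<^sup>+p. ennreal ((cmod (K p))\<^sup>2) \<partial>plane2) = (\<integral>\<^sup>+p. ennreal ((cmod (K (T p)))\<^sup>2) \<partial>plane2)"
    by (rule nnT[symmetric]) measurable
  also have "\<dots> = (\<integral>\<^sup>+p. (\<lambda>p. ennreal ((cmod (k (fst p) * k (snd p)))\<^sup>2)) (corner_d l p, corner_d m p) \<partial>plane2)"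
    by (simp add: K_def inv norm_mult)
  also have "\<dots> = ennreal ?c * (\<integral>\<^sup>+p. ennreal ((cmod (k (fst p) * k (snd p)))\<^sup>2) \<partial>plane2)"
    by (rule nn_integral_two_corners_d[OF _ lm]) measurable
  also have "\<dots> < \<infinity>"
    using sq_integrable_tensor(1)[OF sigma_finite_lborel k k] sq_integrable_iff_nn_integral
    by (simp add: ennreal_mult_less_top nn_integral_eq_l2norm)
  finally have "sq_integrable plane2 K"
    using lm by (auto simp: sq_integrable_iff_nn_integral ennreal_mult_less_top)
  from weakly_conv_kernel[OF sigma_finite_lborel sigma_finite_lborel this F weakly_conv_cnj[OF F]]
  have "(\<lambda>n. LINT p|plane2. F n (fst p) * cnj (F n (snd p)) * K p) \<longlonglongrightarrow> 0"
    by simp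
  then have "(\<lambda>n. ?c *\<^sub>R (LINT p|plane2. F n (fst p) * cnj (F n (snd p)) * K p)) \<longlonglongrightarrow> ?c *\<^sub>R 0"
    by (intro tendsto_scaleR tendsto_const)
  moreover have "?c *\<^sub>R (LINT p|plane2. F n (fst p) * cnj (F n (snd p)) * K p)
      = (LINT p|plane2. opp_edge_prod (F n) k l p * cnj (opp_edge_prod (F n) k m p))" for n
  proof -
    have "(LINT p|plane2. F n (fst (T p)) * cnj (F n (snd (T p))) * K (T p))
        = ?c *\<^sub>R (LINT p|plane2. F n (fst p) * cnj (F n (snd p)) * K p)"
      by (rule integral_of_nn_integral_transfer[OF T _ nnT]) auto
    then show ?thesis
      unfolding K_def inv by (simp add: T_def opp_edge_prod_def mult_ac)
  qed
  ultimately show ?thesis by simp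
qed

section \<open>The quadrilinear form and its weak continuity\<close>

text \<open>
  A density keeps all Borel sets measurable, so that Borel functions need no restriction to
  \<open>{-1..1}\<close>.
\<close>

definition par_measure :: "real measure" where
  "par_measure = density lborel (\<lambda>l. ennreal (indicat_real {-1..1} l))"

lemma sets_par_measure [measurable_cong, simp]: "sets par_measure = sets borel"
  and space_par_measure [simp]: "space par_measure = UNIV"
  by (simp_all add: par_measure_def)

lemma emeasure_par_measure [simp]: "emeasure par_measure UNIV = 2"
  by (simp add: par_measure_def emeasure_density ennreal_indicator)

lemma finite_par_measure: "finite_measure par_measure"
  by (rule finite_measureI) simp

lemma sigma_finite_par_measure: "sigma_finite_measure par_measure"
  using finite_par_measure by (simp add: finite_measure_def)

lemma AE_par_measure_distinct: "AE s in par_measure \<Otimes>\<^sub>M par_measure. fst s \<noteq> snd s"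
proof -
  interpret pair_sigma_finite par_measure par_measure
    by (simp add: pair_sigma_finite_def sigma_finite_par_measure)
  show ?thesis
  proof (rule AE_pair_measure)
    show "{s \<in> space (par_measure \<Otimes>\<^sub>M par_measure). fst s \<noteq> snd s} \<in> sets (par_measure \<Otimes>\<^sub>M par_measure)"
      by measurable
    have "AE m in par_measure. m \<noteq> l" for l
      unfolding par_measure_def using AE_lborel_singleton[of l]
      by (subst AE_density) auto
    then show "AE l in par_measure. AE m in par_measure. fst (l, m) \<noteq> snd (l, m)"
      by - (rule AE_I2, simp add: eq_commute)
  qed
qed

definition edge_prod ::
    "(real^2 \<Rightarrow> complex) \<Rightarrow> (real^2 \<Rightarrow> complex) \<Rightarrow> (real^2) \<times> (real^2) \<Rightarrow> complex" where
  "edge_prod g h p = cnj (g (fst p)) * h (snd p)"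

text \<open>
  The pairing of the trilinear operator with \<open>k\<close>, written in the variables \<open>(b, c)\<close>.  Only the
  second factor depends on \<open>l\<close>, so the average over \<open>l\<close> acts on the opposite edge alone.
\<close>

definition rect_form ::
    "(real^2 \<Rightarrow> complex) \<Rightarrow> (real^2 \<Rightarrow> complex) \<Rightarrow> (real^2 \<Rightarrow> complex) \<Rightarrow> (real^2 \<Rightarrow> complex) \<Rightarrow> complex" where
  "rect_form f g h k = (LINT l|par_measure. LINT p|plane2. edge_prod g h p * opp_edge_prod f k l p)"

lemma sq_integrable_edge_prod:
  assumes "sq_integrable lborel g" "sq_integrable lborel h"
  shows "sq_integrable plane2 (edge_prod g h)"
    and "l2norm plane2 (edge_prod g h) \<le> l2norm lborel g * l2norm lborel h"
  using sq_integrable_tensor[OF sigma_finite_lborel sq_integrable_cnj[OF assms(1)] assms(2)]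
  by (simp_all add: edge_prod_def[abs_def])

lemma measurable_opp_edge_prod [measurable (raw)]:
  assumes "sq_integrable lborel f" "sq_integrable lborel k"
    and [measurable]: "a \<in> borel_measurable T" "b \<in> measurable T plane2"
  shows "(\<lambda>x. opp_edge_prod f k (a x) (b x)) \<in> borel_measurable T"
proof -
  have [measurable]: "f \<in> borel_measurable borel" "k \<in> borel_measurable borel"
    using assms by (auto simp: sq_integrable_def)
  show ?thesis unfolding opp_edge_prod_def by measurable
qed

lemma opp_edge_prod_measurable_pair:
  assumes "sq_integrable lborel f" "sq_integrable lborel k"
  shows "case_prod (opp_edge_prod f k) \<in> borel_measurable (par_measure \<Otimes>\<^sub>M plane2)"
  unfolding case_prod_unfold by (rule measurable_opp_edge_prod[OF assms]) measurable

lemmas opp_edge_prod_average = average_sq_integrable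
  [OF finite_par_measure sigma_finite_plane2 opp_edge_prod_measurable_pair
      sq_integrable_opp_edge_prod(1) sq_integrable_opp_edge_prod(2)]

text \<open>
  The kernels of the Hilbert--Schmidt forms are not bounded in \<open>L\<^sup>2\<close> as \<open>l - m\<close> tends to zero, but
  the inner products are, by the norm of the products themselves; and equal ratios form a null set.
\<close>

lemma opp_edge_prod_average_tendsto_0:
  assumes F: "weakly_conv lborel F (\<lambda>_. 0)" and k: "sq_integrable lborel k"
  shows "(\<lambda>n. l2norm plane2 (\<lambda>p. LINT l|par_measure. opp_edge_prod (F n) k l p)) \<longlonglongrightarrow> 0"
proof -
  have Fn: "sq_integrable lborel (F n)" for n
    using F by (simp add: weakly_conv_def)
  obtain C where C: "\<And>n. l2norm lborel (F n) \<le> C"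
    using weakly_conv_imp_bounded[OF F] by blast
  show ?thesis
  proof (rule average_tendsto_0[OF finite_par_measure sigma_finite_plane2])
    show "case_prod (opp_edge_prod (F n) k) \<in> borel_measurable (par_measure \<Otimes>\<^sub>M plane2)" for n
      by (rule opp_edge_prod_measurable_pair[OF Fn k])
    show "sq_integrable plane2 (opp_edge_prod (F n) k l)" for n l
      by (rule sq_integrable_opp_edge_prod(1)[OF Fn k])
    show "l2norm plane2 (opp_edge_prod (F n) k l) \<le> C * l2norm lborel k" for n l
      by (rule order_trans[OF sq_integrable_opp_edge_prod(2)[OF Fn k] mult_right_mono[OF C]]) simp
    show "AE s in par_measure \<Otimes>\<^sub>M par_measure.
        (\<lambda>n. LINT p|plane2. opp_edge_prod (F n) k (fst s) p * cnj (opp_edge_prod (F n) k (snd s) p)) \<longlonglongrightarrow> 0"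
      using AE_par_measure_distinct
      by eventually_elim (rule opp_edge_prod_orthogonal[OF F k])
  qed
qed

lemma rect_form_eq_average:
  assumes "sq_integrable lborel f" "sq_integrable lborel g" "sq_integrable lborel h" "sq_integrable lborel k"
  shows "rect_form f g h k = (LINT p|plane2. edge_prod g h p * (LINT l|par_measure. opp_edge_prod f k l p))"
  unfolding rect_form_def
  by (rule opp_edge_prod_average(3)[OF assms(1,4) assms(1,4) assms(1,4)])
     (rule sq_integrable_edge_prod(1)[OF assms(2,3)])

lemma rect_form_diff:
  assumes f: "sq_integrable lborel f" and f': "sq_integrable lborel f'"
    and "sq_integrable lborel g" "sq_integrable lborel h" and k: "sq_integrable lborel k"
  shows "rect_form (\<lambda>x. f x - f' x) g h k = rect_form f g h k - rect_form f' g h k"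
proof -
  note y = sq_integrable_edge_prod(1)[OF assms(3,4)]
  have "rect_form f g h k - rect_form f' g h k
      = (LINT l|par_measure. (LINT p|plane2. edge_prod g h p * opp_edge_prod f k l p)
                           - (LINT p|plane2. edge_prod g h p * opp_edge_prod f' k l p))"
    unfolding rect_form_def
    by (subst Bochner_Integration.integral_diff)
       (rule opp_edge_prod_average(4)[OF f k f k f k y] opp_edge_prod_average(4)[OF f' k f' k f' k y] refl)+
  also have "\<dots> = rect_form (\<lambda>x. f x - f' x) g h k"
    unfolding rect_form_def
  proof (rule Bochner_Integration.integral_cong[OF refl])
    fix l
    have "(LINT p|plane2. edge_prod g h p * opp_edge_prod f k l p) - (LINT p|plane2. edge_prod g h p * opp_edge_prod f' k l p)
        = (LINT p|plane2. edge_prod g h p * opp_edge_prod f k l p - edge_prod g h p * opp_edge_prod f' k l p)"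
      by (rule Bochner_Integration.integral_diff[symmetric])
         (intro integrable_mult_sq_integrable y sq_integrable_opp_edge_prod f f' k)+
    then show "(LINT p|plane2. edge_prod g h p * opp_edge_prod f k l p) - (LINT p|plane2. edge_prod g h p * opp_edge_prod f' k l p)
        = (LINT p|plane2. edge_prod g h p * opp_edge_prod (\<lambda>x. f x - f' x) k l p)"
      by (simp add: opp_edge_prod_def algebra_simps)
  qed
  finally show ?thesis by simp
qed

text \<open>
  The sequence \<open>F n\<close> is replaced by its limit first: the error is bounded by the norm of the averaged
  product over the edge \<open>a d\<close>, uniformly in \<open>G n\<close> and \<open>H n\<close>.  What remains is a Hilbert--Schmidt form
  in \<open>G n\<close> and \<open>H n\<close> whose kernel, the average for the limit \<open>f\<close>, is fixed.
\<close>

lemma rect_form_weakly_continuous: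
  assumes F: "weakly_conv lborel F f" and G: "weakly_conv lborel G g" and H: "weakly_conv lborel H h"
    and k: "sq_integrable lborel k"
  shows "(\<lambda>n. rect_form (F n) (G n) (H n) k) \<longlonglongrightarrow> rect_form f g h k"
proof -
  have Fn: "sq_integrable lborel (F n)" and f: "sq_integrable lborel f"
    and Gn: "sq_integrable lborel (G n)" and g: "sq_integrable lborel g"
    and Hn: "sq_integrable lborel (H n)" and h: "sq_integrable lborel h" for n
    using F G H by (auto simp: weakly_conv_def)
  obtain C where C: "\<And>n. l2norm lborel (G n) \<le> C" "0 \<le> C"
    using weakly_conv_imp_bounded[OF G] by blast
  obtain D where D: "\<And>n. l2norm lborel (H n) \<le> D" "0 \<le> D"
    using weakly_conv_imp_bounded[OF H] by blast
  let ?A = "\<lambda>u p. LINT l|par_measure. opp_edge_prod u k l p"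
  have A: "sq_integrable plane2 (?A u)" if "sq_integrable lborel u" for u
    by (rule opp_edge_prod_average(1)[OF that k that k that k])
  note F' = weakly_conv_diff[OF F]
  have F'n: "sq_integrable lborel (\<lambda>x. F n x - f x)" for n
    by (rule sq_integrable_diff[OF Fn f])
  have lim: "(\<lambda>n. C * D * l2norm plane2 (?A (\<lambda>x. F n x - f x))) \<longlonglongrightarrow> 0"
    by (intro tendsto_mult_right_zero opp_edge_prod_average_tendsto_0 F' k)
  have bd: "cmod (rect_form (\<lambda>x. F n x - f x) (G n) (H n) k)
      \<le> C * D * l2norm plane2 (?A (\<lambda>x. F n x - f x))" for n
  proof -
    have "cmod (rect_form (\<lambda>x. F n x - f x) (G n) (H n) k)
        \<le> l2norm plane2 (edge_prod (G n) (H n)) * l2norm plane2 (?A (\<lambda>x. F n x - f x))"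
      unfolding rect_form_eq_average[OF F'n Gn Hn k]
      by (intro Cauchy_Schwarz_integral sq_integrable_edge_prod Gn Hn A F'n)
    also have "\<dots> \<le> (C * D) * l2norm plane2 (?A (\<lambda>x. F n x - f x))"
    proof (rule mult_right_mono)
      show "l2norm plane2 (edge_prod (G n) (H n)) \<le> C * D"
        using sq_integrable_edge_prod(2)[OF Gn Hn] mult_mono[OF C(1) D(1) C(2) l2norm_nonneg]
        by (rule order_trans)
    qed simp
    finally show ?thesis .
  qed
  have 1: "(\<lambda>n. rect_form (\<lambda>x. F n x - f x) (G n) (H n) k) \<longlonglongrightarrow> 0"
    by (rule Lim_null_comparison[OF always_eventually[OF allI[OF bd]] lim])
  have 2: "(\<lambda>n. rect_form f (G n) (H n) k) \<longlonglongrightarrow> rect_form f g h k"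
    unfolding rect_form_eq_average[OF f Gn Hn k] rect_form_eq_average[OF f g h k] edge_prod_def
    by (rule weakly_conv_kernel[OF sigma_finite_lborel sigma_finite_lborel A[OF f] weakly_conv_cnj[OF G] H])
  show ?thesis
    using tendsto_add[OF 1 2] by (simp add: rect_form_diff[OF Fn f Gn Hn k])
qed

section \<open>The trilinear operator on Borel functions\<close>

definition borel_trilin ::
  "(real^2 \<Rightarrow> complex) \<Rightarrow> (real^2 \<Rightarrow> complex) \<Rightarrow> (real^2 \<Rightarrow> complex) \<Rightarrow> real^2 \<Rightarrow> complex" where
  "borel_trilin f g h \<xi> = (LINT l|par_measure. LINT x|lborel.
     f (\<xi> + x) * cnj (g (\<xi> + x + l *\<^sub>R perp x)) * h (\<xi> + l *\<^sub>R perp x))"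

lemma borel_trilin_measurable [measurable]:
  assumes [measurable]: "f \<in> borel_measurable borel" "g \<in> borel_measurable borel" "h \<in> borel_measurable borel"
  shows "borel_trilin f g h \<in> borel_measurable borel"
proof -
  interpret par: sigma_finite_measure par_measure by (rule sigma_finite_par_measure)
  show ?thesis
    unfolding borel_trilin_def[abs_def]
    by (intro par.borel_measurable_lebesgue_integral lborel.borel_measurable_lebesgue_integral) measurable
qed

lemma norm_integral_le_nn_integral:
  fixes f :: "'a \<Rightarrow> 'b::{banach, second_countable_topology}"
  shows "ennreal (norm (integral\<^sup>L M f)) \<le> (\<integral>\<^sup>+x. ennreal (norm (f x)) \<partial>M)"
  by (cases "integrable M f") (simp_all add: integral_norm_bound_ennreal not_integrable_integral_eq)

text \<open>
  The Cauchy--Schwarz inequality in \<open>(l, x)\<close> for the pairing of \<open>f\<close> against \<open>g h\<close>; only the adjacent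
  corners carrying \<open>g\<close> and \<open>h\<close> have to be integrated jointly.
\<close>

lemma sq_integrable_borel_trilin:
  assumes f: "sq_integrable lborel f" and g: "sq_integrable lborel g" and h: "sq_integrable lborel h"
  shows "sq_integrable lborel (borel_trilin f g h)"
proof -
  have [measurable]: "f \<in> borel_measurable borel" "g \<in> borel_measurable borel" "h \<in> borel_measurable borel"
    using f g h by (auto simp: sq_integrable_def)
  interpret PL: pair_sigma_finite par_measure "lborel :: (real^2) measure"
    by (simp add: pair_sigma_finite_def sigma_finite_par_measure sigma_finite_lborel)
  let ?f = "\<lambda>\<xi> s. ennreal (cmod (f (\<xi> + snd s)))"
  let ?gh = "\<lambda>\<xi> l x. ennreal (cmod (g (\<xi> + x + l *\<^sub>R perp x) * h (\<xi> + l *\<^sub>R perp x)))"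
  let ?Z = "\<lambda>\<xi>. \<integral>\<^sup>+l. \<integral>\<^sup>+x. (?gh \<xi> l x)\<^sup>2 \<partial>lborel \<partial>par_measure"
  let ?m = "emeasure par_measure UNIV"
  have "ennreal ((cmod (borel_trilin f g h \<xi>))\<^sup>2) \<le> ?m * ennreal ((l2norm lborel f)\<^sup>2) * ?Z \<xi>" for \<xi>
  proof -
    have "ennreal (cmod (borel_trilin f g h \<xi>)) \<le> (\<integral>\<^sup>+l. \<integral>\<^sup>+x. ?f \<xi> (l, x) * ?gh \<xi> l x \<partial>lborel \<partial>par_measure)"
      unfolding borel_trilin_def
      by (rule order_trans[OF norm_integral_le_nn_integral nn_integral_mono],
          rule order_trans[OF norm_integral_le_nn_integral nn_integral_mono])
         (simp add: norm_mult ennreal_mult mult_ac)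
    also have "\<dots> = (\<integral>\<^sup>+s. ?f \<xi> s * ?gh \<xi> (fst s) (snd s) \<partial>(par_measure \<Otimes>\<^sub>M lborel))"
      by (subst lborel.nn_integral_fst[symmetric]) auto
    finally have "(ennreal (cmod (borel_trilin f g h \<xi>)))\<^sup>2
        \<le> (\<integral>\<^sup>+s. ?f \<xi> s * ?gh \<xi> (fst s) (snd s) \<partial>(par_measure \<Otimes>\<^sub>M lborel))\<^sup>2"
      by (rule power_mono) simp
    also have "\<dots> \<le> (\<integral>\<^sup>+s. (?f \<xi> s)\<^sup>2 \<partial>(par_measure \<Otimes>\<^sub>M lborel))
        * (\<integral>\<^sup>+s. (?gh \<xi> (fst s) (snd s))\<^sup>2 \<partial>(par_measure \<Otimes>\<^sub>M lborel))"
      by (rule Cauchy_Schwarz_nn_integral) measurable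
    also have "(\<integral>\<^sup>+s. (?gh \<xi> (fst s) (snd s))\<^sup>2 \<partial>(par_measure \<Otimes>\<^sub>M lborel)) = ?Z \<xi>"
      by (subst lborel.nn_integral_fst[symmetric]) auto
    also have "(\<integral>\<^sup>+s. (?f \<xi> s)\<^sup>2 \<partial>(par_measure \<Otimes>\<^sub>M lborel))
        = (\<integral>\<^sup>+l. \<integral>\<^sup>+x. (?f \<xi> (l, x))\<^sup>2 \<partial>lborel \<partial>par_measure)"
      by (subst lborel.nn_integral_fst[symmetric]) auto
    also have "\<dots> = (\<integral>\<^sup>+l. ennreal ((l2norm lborel f)\<^sup>2) \<partial>par_measure)"
      using nn_integral_shift[of "\<lambda>x. ennreal ((cmod (f x))\<^sup>2)" \<xi>]
      by (simp add: ennreal_power nn_integral_eq_l2norm[OF f])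
    also have "\<dots> = ?m * ennreal ((l2norm lborel f)\<^sup>2)"
      by (simp add: mult.commute)
    finally show ?thesis
      by (simp add: ennreal_power)
  qed
  then have "(\<integral>\<^sup>+\<xi>. ennreal ((cmod (borel_trilin f g h \<xi>))\<^sup>2) \<partial>lborel)
      \<le> (\<integral>\<^sup>+\<xi>. ?m * ennreal ((l2norm lborel f)\<^sup>2) * ?Z \<xi> \<partial>lborel)"
    by (rule nn_integral_mono)
  also have "\<dots> = ?m * ennreal ((l2norm lborel f)\<^sup>2) * (\<integral>\<^sup>+\<xi>. ?Z \<xi> \<partial>lborel)"
    by (rule nn_integral_cmult) measurable
  also have "(\<integral>\<^sup>+\<xi>. ?Z \<xi> \<partial>lborel) = (\<integral>\<^sup>+l. \<integral>\<^sup>+\<xi>. \<integral>\<^sup>+x. (?gh \<xi> l x)\<^sup>2 \<partial>lborel \<partial>lborel \<partial>par_measure)"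
    by (rule PL.Fubini') measurable
  also have "\<dots> = (\<integral>\<^sup>+l. ennreal ((l2norm plane2 (edge_prod g h))\<^sup>2) \<partial>par_measure)"
  proof (rule nn_integral_cong)
    fix l
    have "(\<integral>\<^sup>+\<xi>. \<integral>\<^sup>+x. (?gh \<xi> l x)\<^sup>2 \<partial>lborel \<partial>lborel) = (\<integral>\<^sup>+p. (\<lambda>(\<xi>, x). (?gh \<xi> l x)\<^sup>2) p \<partial>plane2)"
      by (subst nn_integral_plane2(1)) auto
    also have "\<dots> = (\<integral>\<^sup>+p. (\<lambda>(\<xi>, x). (?gh \<xi> l x)\<^sup>2) (corner_d l p, fst p - snd p) \<partial>plane2)"
      by (rule nn_integral_edge[symmetric]) measurable
    also have "\<dots> = (\<integral>\<^sup>+p. ennreal ((cmod (edge_prod g h p))\<^sup>2) \<partial>plane2)"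
      by (simp add: corner_d_def edge_prod_def norm_mult ennreal_power)
    also have "\<dots> = ennreal ((l2norm plane2 (edge_prod g h))\<^sup>2)"
      by (rule nn_integral_eq_l2norm) (rule sq_integrable_edge_prod(1)[OF g h])
    finally show "(\<integral>\<^sup>+\<xi>. \<integral>\<^sup>+x. (?gh \<xi> l x)\<^sup>2 \<partial>lborel \<partial>lborel) = ennreal ((l2norm plane2 (edge_prod g h))\<^sup>2)" .
  qed
  also have "?m * ennreal ((l2norm lborel f)\<^sup>2) * \<dots> < \<infinity>"
    by (simp add: ennreal_mult_less_top)
  finally show ?thesis
    by (simp add: sq_integrable_iff_nn_integral)
qed

text \<open>
  For fixed \<open>l\<close> the passage from \<open>(\<xi>, x)\<close> to the edge \<open>(b, c)\<close> preserves the measure; moving the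
  integral over \<open>l\<close> outside is justified by the bound on the integral over the edge, which does not
  depend on \<open>l\<close>.
\<close>

lemma integral_borel_trilin_eq_rect_form:
  assumes f: "sq_integrable lborel f" and g: "sq_integrable lborel g" and h: "sq_integrable lborel h"
    and k: "sq_integrable lborel k"
  shows "(LINT \<xi>|lborel. borel_trilin f g h \<xi> * cnj (k \<xi>)) = rect_form f g h k"
proof -
  have [measurable]: "f \<in> borel_measurable borel" "g \<in> borel_measurable borel"
    "h \<in> borel_measurable borel" "k \<in> borel_measurable borel"
    using f g h k by (auto simp: sq_integrable_def)
  interpret PL: pair_sigma_finite par_measure "lborel :: (real^2) measure"
    by (simp add: pair_sigma_finite_def sigma_finite_par_measure sigma_finite_lborel)
  have "sigma_finite_measure (par_measure \<Otimes>\<^sub>M (lborel :: (real^2) measure))"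
    by (intro sigma_finite_pair_measure sigma_finite_par_measure sigma_finite_lborel)
  then interpret PLL: pair_sigma_finite "par_measure \<Otimes>\<^sub>M (lborel :: (real^2) measure)" "lborel :: (real^2) measure"
    by (simp add: pair_sigma_finite_def sigma_finite_lborel)
  define \<Psi> where "\<Psi> l \<xi> x = f (\<xi> + x) * cnj (g (\<xi> + x + l *\<^sub>R perp x)) * h (\<xi> + l *\<^sub>R perp x) * cnj (k \<xi>)"
    for l \<xi> x
  have \<Psi>_meas [measurable]: "(\<lambda>s. \<Psi> (a s) (b s) (c s)) \<in> borel_measurable T"
    if [measurable]: "a \<in> borel_measurable T" "b \<in> borel_measurable T" "c \<in> borel_measurable T"
    for a b c and T :: "'t measure"
    unfolding \<Psi>_def by measurable
  have \<Psi>_edge: "\<Psi> l (corner_d l p) (fst p - snd p) = edge_prod g h p * opp_edge_prod f k l p" for l p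
    by (simp add: \<Psi>_def edge_prod_def opp_edge_prod_def corner_d_def corner_a_def)
  have edge_meas: "(\<lambda>p. (corner_d l p, fst p - snd p)) \<in> measurable plane2 plane2" for l
    by measurable
  have nn_edge: "(\<integral>\<^sup>+p. ennreal (cmod (\<Psi> l (fst p) (snd p))) \<partial>plane2)
      = (\<integral>\<^sup>+p. ennreal (cmod (edge_prod g h p * opp_edge_prod f k l p)) \<partial>plane2)" for l
    using nn_integral_edge[of "\<lambda>p. ennreal (cmod (\<Psi> l (fst p) (snd p)))" l]
    by (simp add: \<Psi>_edge)
  let ?B = "l2norm plane2 (edge_prod g h) * (l2norm lborel f * l2norm lborel k)"
  have nn_le: "(\<integral>\<^sup>+p. ennreal (cmod (\<Psi> l (fst p) (snd p))) \<partial>plane2) \<le> ennreal ?B" for l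
  proof -
    note y = sq_integrable_edge_prod(1)[OF g h] and q = sq_integrable_opp_edge_prod[OF f k, of l]
    have "(\<integral>\<^sup>+p. ennreal (cmod (\<Psi> l (fst p) (snd p))) \<partial>plane2)
        = ennreal (LINT p|plane2. cmod (edge_prod g h p * opp_edge_prod f k l p))"
      unfolding nn_edge
      by (rule nn_integral_eq_integral[OF integrable_norm[OF integrable_mult_sq_integrable[OF y q(1)]]]) simp
    also have "\<dots> \<le> ennreal ?B"
      by (rule ennreal_leI)
         (rule order_trans[OF Cauchy_Schwarz_norm[OF y q(1)] mult_left_mono[OF q(2)]], simp)
    finally show ?thesis .
  qed
  have int_l: "integrable plane2 (\<lambda>(\<xi>, x). \<Psi> l \<xi> x)" for l
  proof (rule integrableI_bounded)
    show "(\<integral>\<^sup>+p. ennreal (norm (case p of (\<xi>, x) \<Rightarrow> \<Psi> l \<xi> x)) \<partial>plane2) < \<infinity>"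
      using le_less_trans[OF nn_le[of l] ennreal_less_top] by (simp add: case_prod_unfold)
  qed measurable
  have \<Psi>_l: "(LINT \<xi>|lborel. LINT x|lborel. \<Psi> l \<xi> x) = (LINT p|plane2. edge_prod g h p * opp_edge_prod f k l p)" for l
  proof -
    have "(LINT \<xi>|lborel. LINT x|lborel. \<Psi> l \<xi> x) = (LINT p|plane2. \<Psi> l (fst p) (snd p))"
      using lborel_pair.integral_fst[OF int_l[of l]] by (simp add: case_prod_unfold)
    also have "\<dots> = (LINT p|plane2. edge_prod g h p * opp_edge_prod f k l p)"
      using integral_of_nn_integral_transfer[OF edge_meas[of l], of 1 "\<lambda>p. \<Psi> l (fst p) (snd p)"]
        nn_integral_edge[of _ l] by (simp add: \<Psi>_edge)
    finally show ?thesis .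
  qed
  have int: "integrable ((par_measure \<Otimes>\<^sub>M lborel) \<Otimes>\<^sub>M lborel) (\<lambda>(s, x). \<Psi> (fst s) (snd s) x)"
  proof (rule integrableI_bounded)
    have "(\<integral>\<^sup>+t. ennreal (norm (case t of (s, x) \<Rightarrow> \<Psi> (fst s) (snd s) x)) \<partial>((par_measure \<Otimes>\<^sub>M lborel) \<Otimes>\<^sub>M lborel))
        = (\<integral>\<^sup>+s. \<integral>\<^sup>+x. ennreal (cmod (\<Psi> (fst s) (snd s) x)) \<partial>lborel \<partial>(par_measure \<Otimes>\<^sub>M lborel))"
      by (subst lborel.nn_integral_fst[symmetric]) auto
    also have "\<dots> = (\<integral>\<^sup>+l. \<integral>\<^sup>+\<xi>. \<integral>\<^sup>+x. ennreal (cmod (\<Psi> l \<xi> x)) \<partial>lborel \<partial>lborel \<partial>par_measure)"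
      by (subst lborel.nn_integral_fst[symmetric]) auto
    also have "\<dots> = (\<integral>\<^sup>+l. \<integral>\<^sup>+p. ennreal (cmod (\<Psi> l (fst p) (snd p))) \<partial>plane2 \<partial>par_measure)"
      by (subst nn_integral_plane2(1)) auto
    also have "\<dots> \<le> (\<integral>\<^sup>+l. ennreal ?B \<partial>par_measure)"
      by (intro nn_integral_mono nn_le)
    also have "\<dots> < \<infinity>"
      by (simp add: ennreal_mult_less_top)
    finally show "(\<integral>\<^sup>+t. ennreal (norm (case t of (s, x) \<Rightarrow> \<Psi> (fst s) (snd s) x))
        \<partial>((par_measure \<Otimes>\<^sub>M lborel) \<Otimes>\<^sub>M lborel)) < \<infinity>" .
  qed measurable
  have int2: "integrable (par_measure \<Otimes>\<^sub>M lborel) (\<lambda>(l, \<xi>). LINT x|lborel. \<Psi> l \<xi> x)"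
    using PLL.integrable_fst[OF int] by (simp add: case_prod_unfold)
  have "(LINT \<xi>|lborel. borel_trilin f g h \<xi> * cnj (k \<xi>))
      = (LINT \<xi>|lborel. LINT l|par_measure. LINT x|lborel. \<Psi> l \<xi> x)"
    by (simp add: borel_trilin_def \<Psi>_def)
  also have "\<dots> = (LINT l|par_measure. LINT \<xi>|lborel. LINT x|lborel. \<Psi> l \<xi> x)"
    by (rule PL.Fubini_integral[OF int2])
  also have "\<dots> = rect_form f g h k"
    unfolding rect_form_def by (simp add: \<Psi>_l)
  finally show ?thesis .
qed

section \<open>Borel representatives\<close>

lemma AE_lebesgue_iff: "(AE x in lebesgue. P x) \<longleftrightarrow> (AE x in lborel. P x)"
  by (rule AE_completion_iff)

lemma borel_imp_lebesgue_measurable: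
  "f \<in> borel_measurable borel \<Longrightarrow> f \<in> borel_measurable lebesgue"
  by (rule measurable_completion) simp

lemma lebesgue_measurable_cong_AE:
  fixes f f' :: "'a::euclidean_space \<Rightarrow> 'b::euclidean_space"
  assumes "f' \<in> borel_measurable lebesgue" "AE x in lebesgue. f x = f' x"
  shows "f \<in> borel_measurable lebesgue"
  by (rule borel_measurable_AE[OF assms(1)]) (use assms(2) in \<open>simp add: eq_commute\<close>)

lemma L2_borel_representative:
  assumes "f \<in> L2"
  obtains f' where "sq_integrable lborel f'" "AE x in lebesgue. f x = f' x"
proof -
  have f: "f \<in> borel_measurable lebesgue" "integrable lebesgue (\<lambda>x. (cmod (f x))\<^sup>2)"
    using assms by (auto simp: L2_def)
  obtain a where a[measurable]: "a \<in> borel_measurable lborel" and ae_a: "AE x in lborel. Re (f x) = a x"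
    using completion_ex_borel_measurable_real[of "\<lambda>x. Re (f x)" lborel]
      measurable_compose[OF f(1) borel_measurable_Re] by auto
  obtain b where b[measurable]: "b \<in> borel_measurable lborel" and ae_b: "AE x in lborel. Im (f x) = b x"
    using completion_ex_borel_measurable_real[of "\<lambda>x. Im (f x)" lborel]
      measurable_compose[OF f(1) borel_measurable_Im] by auto
  define f' where "f' x = Complex (a x) (b x)" for x
  have f'_eq: "f' = (\<lambda>x. complex_of_real (a x) + \<i> * complex_of_real (b x))"
    by (auto simp: f'_def complex_eq_iff)
  have meas: "f' \<in> borel_measurable borel"
    using a b unfolding f'_eq by simp
  have ae: "AE x in lebesgue. f x = f' x"
    unfolding AE_lebesgue_iff using ae_a ae_b by eventually_elim (simp add: f'_def complex_eq_iff)
  have "integrable lebesgue (\<lambda>x. (cmod (f' x))\<^sup>2)"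
    by (rule integrable_cong_AE_imp[OF f(2)])
       (use ae borel_imp_lebesgue_measurable[of "\<lambda>x. (cmod (f' x))\<^sup>2"] meas in auto)
  then have "integrable lborel (\<lambda>x. (cmod (f' x))\<^sup>2)"
    using integrable_completion[of "\<lambda>x. (cmod (f' x))\<^sup>2" lborel] meas by simp
  then show thesis
    by (intro that[of f'] ae) (simp add: sq_integrable_def meas)
qed

lemma sq_integrable_imp_L2:
  assumes "sq_integrable lborel f" shows "f \<in> L2"
proof -
  have "f \<in> borel_measurable borel" and int: "integrable lborel (\<lambda>x. (cmod (f x))\<^sup>2)"
    using assms by (simp_all add: sq_integrable_def)
  moreover have "integrable lebesgue (\<lambda>x. (cmod (f x))\<^sup>2)"
    using integrable_completion[OF borel_measurable_integrable[OF int]] int by blast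
  ultimately show ?thesis
    unfolding L2_def mem_Collect_eq by (intro conjI borel_imp_lebesgue_measurable)
qed

lemma L2_inner_borel:
  assumes u: "sq_integrable lborel u'" "AE x in lebesgue. u x = u' x"
    and k: "sq_integrable lborel k'" "AE x in lebesgue. k x = k' x"
  shows "L2_inner u k = (LINT x|lborel. u' x * cnj (k' x))"
proof -
  have meas: "(\<lambda>x. u' x * cnj (k' x)) \<in> borel_measurable borel"
    using borel_measurable_integrable[OF integrable_mult_sq_integrable[OF u(1) sq_integrable_cnj[OF k(1)]]]
    by simp
  have ae: "AE x in lebesgue. u x * cnj (k x) = u' x * cnj (k' x)"
    using u(2) k(2) by eventually_elim simp
  have "L2_inner u k = (LINT x|lebesgue. u' x * cnj (k' x))"
    unfolding L2_inner_def
    using borel_imp_lebesgue_measurable[OF meas] ae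
    by (intro integral_cong_AE lebesgue_measurable_cong_AE[OF _ ae])
  also have "\<dots> = (LINT x|lborel. u' x * cnj (k' x))"
    using meas by (intro integral_completion) simp
  finally show ?thesis .
qed

lemma weakly_converges_L2_borel:
  assumes weak: "weakly_converges_L2 u v"
    and u: "\<And>n. sq_integrable lborel (u' n)" "\<And>n. AE x in lebesgue. u n x = u' n x"
    and v: "sq_integrable lborel v'" "AE x in lebesgue. v x = v' x"
  shows "weakly_conv lborel u' v'"
  unfolding weakly_conv_def
proof (intro conjI allI impI u v)
  fix k :: "real^2 \<Rightarrow> complex" assume "sq_integrable lborel k"
  then have k: "sq_integrable lborel (\<lambda>x. cnj (k x))"
    by (rule sq_integrable_cnj)
  have "(\<lambda>n. L2_inner (u n) (\<lambda>x. cnj (k x))) \<longlonglongrightarrow> L2_inner v (\<lambda>x. cnj (k x))"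
    using weak sq_integrable_imp_L2[OF k] by (simp add: weakly_converges_L2_def)
  then show "(\<lambda>n. LINT x|lborel. u' n x * k x) \<longlonglongrightarrow> (LINT x|lborel. v' x * k x)"
    using L2_inner_borel[OF u k AE_I2] L2_inner_borel[OF v k AE_I2] by simp
qed

lemma AE_lebesgue_affine:
  fixes P :: "'a::euclidean_space \<Rightarrow> bool" and T :: "'a \<Rightarrow> 'a"
  assumes P: "AE x in lebesgue. P x" and T: "linear T" "inj T"
  shows "AE x in lebesgue. P (c + T x)"
proof -
  have neg: "negligible {x. \<not> P x}"
    using P unfolding negligible_iff_null_sets eventually_ae_filter
    by (auto intro: null_sets_completion_subset)
  obtain S where S: "linear S" "S \<circ> T = id"
    using linear_injective_left_inverse[OF T] by blast
  have "{x. \<not> P (c + T x)} \<subseteq> S ` ((+) (- c) ` {x. \<not> P x})"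
  proof
    fix x assume "x \<in> {x. \<not> P (c + T x)}"
    moreover have "x = S (- c + (c + T x))"
      using S(2) by (simp add: o_def fun_eq_iff id_def)
    ultimately show "x \<in> S ` ((+) (- c) ` {x. \<not> P x})" by blast
  qed
  moreover have "negligible (S ` ((+) (- c) ` {x. \<not> P x}))"
    by (rule negligible_differentiable_image_negligible[OF _
          negligible_translation[OF neg] linear_imp_differentiable_on[OF S(1)]]) simp
  ultimately have "negligible {x. \<not> P (c + T x)}"
    by (rule negligible_subset[rotated])
  then show ?thesis
    by (intro AE_I'[of "{x. \<not> P (c + T x)}"]) (auto simp: negligible_iff_null_sets)
qed

lemma linear_scaled_perp: "linear (\<lambda>x. l *\<^sub>R perp x)"
  by (rule linearI) (simp_all add: perp_add perp_scaleR algebra_simps)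

lemma linear_id_plus_perp: "linear (\<lambda>x. x + l *\<^sub>R perp x)"
  by (rule linearI) (simp_all add: perp_add perp_scaleR algebra_simps)

lemma inner_perp: "x \<bullet> perp x = 0"
  by (simp add: inner_vec_def sum_2 mult.commute)

lemma inj_scaled_perp: "l \<noteq> 0 \<Longrightarrow> inj (\<lambda>x. l *\<^sub>R perp x)"
  by (rule injI) (metis perp_perp scaleR_left_imp_eq neg_equal_iff_equal)

lemma inj_id_plus_perp: "inj (\<lambda>x. x + l *\<^sub>R perp x)"
proof -
  have "x = 0" if "x + l *\<^sub>R perp x = 0" for x
  proof -
    have "x \<bullet> x = x \<bullet> (x + l *\<^sub>R perp x)"
      by (simp add: inner_add_right inner_perp)
    then show ?thesis using that by simp
  qed
  then show ?thesis
    by (intro linear_injective_0[OF linear_id_plus_perp, THEN iffD2] allI impI)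
qed

text \<open>
  Each of the three arguments of the integrand is an injective affine image of \<open>x\<close> when \<open>l \<noteq> 0\<close>, so
  a change of representatives alters the inner integrand only on a null set.
\<close>

lemma trilin_op_eq_borel_trilin:
  assumes f: "f' \<in> borel_measurable borel" "AE x in lebesgue. f x = f' x"
    and g: "g' \<in> borel_measurable borel" "AE x in lebesgue. g x = g' x"
    and h: "h' \<in> borel_measurable borel" "AE x in lebesgue. h x = h' x"
  shows "trilin_op f g h = borel_trilin f' g' h'"
proof
  fix \<xi> :: "real^2"
  note [measurable] = f(1) g(1) h(1)
  let ?I = "\<lambda>f g h l x. f (\<xi> + x) * cnj (g (\<xi> + x + l *\<^sub>R perp x)) * h (\<xi> + l *\<^sub>R perp x)"
  have meas: "?I f' g' h' l \<in> borel_measurable borel" for l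
    by measurable
  have inner: "(LINT x|lebesgue. ?I f g h l x) = (LINT x|lborel. ?I f' g' h' l x)" if "l \<noteq> 0" for l
  proof -
    have ae: "AE x in lebesgue. ?I f g h l x = ?I f' g' h' l x"
      using AE_lebesgue_affine[OF f(2) linear_id inj_on_id, of \<xi>]
        AE_lebesgue_affine[OF g(2) linear_id_plus_perp inj_id_plus_perp, of \<xi> l]
        AE_lebesgue_affine[OF h(2) linear_scaled_perp inj_scaled_perp[OF that], of \<xi>]
      by eventually_elim (simp add: add.assoc)
    have "(LINT x|lebesgue. ?I f g h l x) = (LINT x|lebesgue. ?I f' g' h' l x)"
      using borel_imp_lebesgue_measurable[OF meas] ae
      by (intro integral_cong_AE lebesgue_measurable_cong_AE[OF _ ae])
    also have "\<dots> = (LINT x|lborel. ?I f' g' h' l x)"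
      using meas by (intro integral_completion) simp
    finally show ?thesis .
  qed
  let ?J = "\<lambda>l. LINT x|lborel. ?I f' g' h' l x"
  have J[measurable]: "?J \<in> borel_measurable borel"
    by (intro lborel.borel_measurable_lebesgue_integral) measurable
  let ?i = "indicat_real {-1..1}"
  have J': "(\<lambda>l. ?i l *\<^sub>R ?J l) \<in> borel_measurable borel"
    by measurable
  have "AE l in lebesgue. l \<noteq> (0::real)"
    unfolding AE_lebesgue_iff by (rule AE_lborel_singleton)
  then have ae: "AE l in lebesgue. ?i l *\<^sub>R (LINT x|lebesgue. ?I f g h l x) = ?i l *\<^sub>R ?J l"
    by eventually_elim (simp add: inner)
  have "trilin_op f g h \<xi> = (LINT l|lebesgue. ?i l *\<^sub>R ?J l)"
    unfolding trilin_op_def set_lebesgue_integral_def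
    using borel_imp_lebesgue_measurable[OF J'] ae
    by (intro integral_cong_AE lebesgue_measurable_cong_AE[OF _ ae])
  also have "\<dots> = (LINT l|lborel. ?i l *\<^sub>R ?J l)"
    using J' by (intro integral_completion) simp
  also have "\<dots> = (LINT l|par_measure. ?J l)"
    unfolding par_measure_def by (rule integral_density[symmetric]) auto
  finally show "trilin_op f g h \<xi> = borel_trilin f' g' h' \<xi>"
    by (simp add: borel_trilin_def)
qed

theorem theorem2p9:
  fixes F G H :: "nat \<Rightarrow> real^2 \<Rightarrow> complex"
    and f g h :: "real^2 \<Rightarrow> complex"
  assumes "weakly_converges_L2 F f"
    and "weakly_converges_L2 G g"
    and "weakly_converges_L2 H h"
  shows "weakly_converges_L2 (\<lambda>n. trilin_op (F n) (G n) (H n)) (trilin_op f g h)"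
proof -
  have rep: "\<exists>u' v'. weakly_conv lborel u' v' \<and> (\<forall>n. AE x in lebesgue. u n x = u' n x)
      \<and> (AE x in lebesgue. v x = v' x)" if weak: "weakly_converges_L2 u v" for u v
  proof -
    have "\<forall>n. \<exists>w. sq_integrable lborel w \<and> (AE x in lebesgue. u n x = w x)"
      using weak L2_borel_representative unfolding weakly_converges_L2_def by metis
    then obtain u' where "\<And>n. sq_integrable lborel (u' n)" "\<And>n. AE x in lebesgue. u n x = u' n x"
      by metis
    moreover obtain v' where "sq_integrable lborel v'" "AE x in lebesgue. v x = v' x"
      using weak L2_borel_representative unfolding weakly_converges_L2_def by metis
    ultimately show ?thesis
      using weakly_converges_L2_borel[OF weak] by blast
  qed
  obtain F' f' where F: "weakly_conv lborel F' f'" "\<And>n. AE x in lebesgue. F n x = F' n x"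
    "AE x in lebesgue. f x = f' x"
    using rep[OF assms(1)] by blast
  obtain G' g' where G: "weakly_conv lborel G' g'" "\<And>n. AE x in lebesgue. G n x = G' n x"
    "AE x in lebesgue. g x = g' x"
    using rep[OF assms(2)] by blast
  obtain H' h' where H: "weakly_conv lborel H' h'" "\<And>n. AE x in lebesgue. H n x = H' n x"
    "AE x in lebesgue. h x = h' x"
    using rep[OF assms(3)] by blast
  have sq: "sq_integrable lborel (F' n)" "sq_integrable lborel (G' n)" "sq_integrable lborel (H' n)"
    "sq_integrable lborel f'" "sq_integrable lborel g'" "sq_integrable lborel h'" for n
    using F(1) G(1) H(1) by (auto simp: weakly_conv_def)
  have meas: "w \<in> borel_measurable borel" if "sq_integrable lborel w" for w :: "real^2 \<Rightarrow> complex"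
    using that by (simp add: sq_integrable_def)
  have eq_n: "trilin_op (F n) (G n) (H n) = borel_trilin (F' n) (G' n) (H' n)" for n
    by (intro trilin_op_eq_borel_trilin meas sq F(2) G(2) H(2))
  have eq: "trilin_op f g h = borel_trilin f' g' h'"
    by (intro trilin_op_eq_borel_trilin meas sq F(3) G(3) H(3))
  note T_n = sq_integrable_borel_trilin[OF sq(1-3)] and T = sq_integrable_borel_trilin[OF sq(4-6)]
  show ?thesis
    unfolding weakly_converges_L2_def eq eq_n
  proof (intro conjI allI ballI)
    show "borel_trilin (F' n) (G' n) (H' n) \<in> L2" for n
      by (rule sq_integrable_imp_L2[OF T_n])
    show "borel_trilin f' g' h' \<in> L2"
      by (rule sq_integrable_imp_L2[OF T])
    fix k assume "k \<in> L2"
    then obtain k' where k: "sq_integrable lborel k'" "AE x in lebesgue. k x = k' x"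
      using L2_borel_representative by blast
    have "L2_inner (borel_trilin (F' n) (G' n) (H' n)) k = rect_form (F' n) (G' n) (H' n) k'" for n
      using L2_inner_borel[OF T_n AE_I2 k] integral_borel_trilin_eq_rect_form[OF sq(1-3) k(1)] by simp
    moreover have "L2_inner (borel_trilin f' g' h') k = rect_form f' g' h' k'"
      using L2_inner_borel[OF T AE_I2 k] integral_borel_trilin_eq_rect_form[OF sq(4-6) k(1)] by simp
    ultimately show "(\<lambda>n. L2_inner (borel_trilin (F' n) (G' n) (H' n)) k)
        \<longlonglongrightarrow> L2_inner (borel_trilin f' g' h') k"
      using rect_form_weakly_continuous[OF F(1) G(1) H(1) k(1)] by simp
  qed
qed

end
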